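(* Let $\varphi:\,]a,\infty[\,\to\mathbb{R}$ be a smooth function with $\dot\varphi>0$ and $\ddot\varphi\ge0$ on $]a,\infty[$. Let $z_0\in\,]a,\infty[$ and let $\gamma(s)=(x(s),0,z(s))$ be the arc-length parametrized curve given by the (maximal) solution of $$x'=\cos\theta,\qquad z'=\sin\theta,\qquad \theta'=\dot\varphi(z)\cos\theta-\frac{\sin\theta}{x},$$ with initial conditions $x(0)=0$, $z(0)=z_0$, $\theta(0)=0$. Then $\gamma$ is the graph of a strictly convex symmetric (even) function $u(x)$ defined on a maximal interval $]-\omega_+,\omega_+[$, which has a minimum at $0$ and satisfies $$\lim_{x\to\pm\omega_+}u(x)=\infty .$$
   Context: A dot is the derivative of $\varphi$ in its variable and $'$ is $d/ds$. The system is the equation for the generating curve of a surface of revolution about the $\vec e_3$-axis to be $[\varphi,\vec e_3]$-minimal, i.e. to have mean curvature vector $\mathbf{H}=\dot\varphi\,\vec e_3^{\,\perp}$. Since the system is singular at $x=0$, the solution is understood in the following sense: $\gamma$ is $C^2$, the system holds for $s\neq 0$, and near $s=0$ the curve is the graph of the unique $C^2$ solution of $u''=(1+u'^2)(\dot\varphi(u)-u'/x)$, $u(0)=z_0$, $u'(0)=0$. Here $\omega_+\in\,]0,+\infty]$. *)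

theory Defs
  imports "HOL-Analysis.Analysis"
begin

text \<open>
  Open intervals with possibly infinite end points are written \<^term>\<open>einterval a b\<close>,
  with \<^term>\<open>a\<close>, \<^term>\<open>b\<close> of type \<^typ>\<open>ereal\<close>; as a set of reals this is
  \<open>{x. a < ereal x \<and> ereal x < b}\<close>.
\<close>

text \<open>On an open set this is smoothness, since the germ of \<^term>\<open>f\<close> at a point determines
  all its derivatives there.\<close>

definition smooth_on_open :: "(real \<Rightarrow> real) \<Rightarrow> real set \<Rightarrow> bool" where
  "smooth_on_open f S \<longleftrightarrow> (\<forall>k. \<forall>x\<in>S. ((deriv ^^ k) f) differentiable (at x))"

text \<open>Twice continuously differentiable; intended for open \<^term>\<open>S\<close>.\<close>

definition C2_on :: "(real \<Rightarrow> 'a::real_normed_vector) \<Rightarrow> real set \<Rightarrow> bool" where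
  "C2_on f S \<longleftrightarrow> f C1_differentiable_on S \<and>
     (\<lambda>t. vector_derivative f (at t)) C1_differentiable_on S"

definition strictly_convex_on :: "real set \<Rightarrow> (real \<Rightarrow> real) \<Rightarrow> bool" where
  "strictly_convex_on S u \<longleftrightarrow> convex S \<and>
     (\<forall>x\<in>S. \<forall>y\<in>S. \<forall>t. x \<noteq> y \<longrightarrow> 0 < t \<longrightarrow> t < 1 \<longrightarrow>
        u ((1 - t) * x + t * y) < (1 - t) * u x + t * u y)"

definition planar_curve :: "(real \<Rightarrow> real) \<Rightarrow> (real \<Rightarrow> real) \<Rightarrow> real \<Rightarrow> real \<times> real \<times> real" where
  "planar_curve x z = (\<lambda>s. (x s, 0, z s))"

definition graph_over :: "(real \<Rightarrow> real) \<Rightarrow> real set \<Rightarrow> (real \<times> real \<times> real) set" where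
  "graph_over u J = (\<lambda>t. (t, 0, u t)) ` J"

definition open_interval_at_0 :: "real set \<Rightarrow> bool" where
  "open_interval_at_0 I \<longleftrightarrow> open I \<and> is_interval I \<and> 0 \<in> I"

text \<open>
  The singular initial value problem \<open>u'' = (1 + u'\<^sup>2) (\<phi>'(u) - u'/x)\<close>, \<open>u 0 = z0\<close>, \<open>u' 0 = 0\<close>,
  on an open interval around \<open>0\<close>; at \<open>x = 0\<close> the equation is not imposed.
\<close>

definition graph_solution ::
    "(real \<Rightarrow> real) \<Rightarrow> ereal \<Rightarrow> real \<Rightarrow> real set \<Rightarrow> (real \<Rightarrow> real) \<Rightarrow> bool" where
  "graph_solution \<phi> a z0 J u \<longleftrightarrow>
     open_interval_at_0 J \<and> C2_on u J \<and> u ` J \<subseteq> einterval a \<infinity> \<and>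
     u 0 = z0 \<and> deriv u 0 = 0 \<and>
     (\<forall>x\<in>J - {0}. deriv (deriv u) x =
        (1 + (deriv u x)\<^sup>2) * (deriv \<phi> (u x) - deriv u x / x))"

definition maximal_graph_solution ::
    "(real \<Rightarrow> real) \<Rightarrow> ereal \<Rightarrow> real \<Rightarrow> real set \<Rightarrow> (real \<Rightarrow> real) \<Rightarrow> bool" where
  "maximal_graph_solution \<phi> a z0 J u \<longleftrightarrow>
     graph_solution \<phi> a z0 J u \<and>
     (\<forall>K v. graph_solution \<phi> a z0 K v \<longrightarrow> J \<subseteq> K \<longrightarrow> (\<forall>x\<in>J. v x = u x) \<longrightarrow> K = J)"

text \<open>
  Solutions on \<^term>\<open>I\<close> of
    \<open>x' = cos \<theta>\<close>, \<open>z' = sin \<theta>\<close>, \<open>\<theta>' = \<phi>'(z) cos \<theta> - sin \<theta> / x\<close>,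
    \<open>x 0 = 0\<close>, \<open>z 0 = z0\<close>, \<open>\<theta> 0 = 0\<close>.
  The system is singular at \<open>x = 0\<close>. It is imposed for \<open>s \<noteq> 0\<close>, where the curve has to stay
  in the domain \<open>x \<noteq> 0\<close> of the system (this must be said, as division by zero is total in HOL).
  Near \<open>s = 0\<close> the curve is the graph of a C2 solution of the singular graph equation; that
  problem has only one C2 solution, which is a fact and not part of the definition.
  The curve is parametrized by arc length because of the first two equations.
\<close>

definition generating_curve ::
    "(real \<Rightarrow> real) \<Rightarrow> ereal \<Rightarrow> real \<Rightarrow> real set \<Rightarrow>
     (real \<Rightarrow> real) \<Rightarrow> (real \<Rightarrow> real) \<Rightarrow> (real \<Rightarrow> real) \<Rightarrow> bool" where
  "generating_curve \<phi> a z0 I x z \<theta> \<longleftrightarrow>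
     open_interval_at_0 I \<and> C2_on (planar_curve x z) I \<and> continuous_on I \<theta> \<and>
     z ` I \<subseteq> einterval a \<infinity> \<and>
     x 0 = 0 \<and> z 0 = z0 \<and> \<theta> 0 = 0 \<and>
     (\<forall>s\<in>I - {0}. x s \<noteq> 0 \<and>
        (x has_real_derivative cos (\<theta> s)) (at s) \<and>
        (z has_real_derivative sin (\<theta> s)) (at s) \<and>
        (\<theta> has_real_derivative deriv \<phi> (z s) * cos (\<theta> s) - sin (\<theta> s) / x s) (at s)) \<and>
     (\<exists>N J u. open_interval_at_0 N \<and> N \<subseteq> I \<and> graph_solution \<phi> a z0 J u \<and>
        planar_curve x z ` N = graph_over u J)"

definition maximal_generating_curve ::
    "(real \<Rightarrow> real) \<Rightarrow> ereal \<Rightarrow> real \<Rightarrow> real set \<Rightarrow>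
     (real \<Rightarrow> real) \<Rightarrow> (real \<Rightarrow> real) \<Rightarrow> (real \<Rightarrow> real) \<Rightarrow> bool" where
  "maximal_generating_curve \<phi> a z0 I x z \<theta> \<longleftrightarrow>
     generating_curve \<phi> a z0 I x z \<theta> \<and>
     (\<forall>I' x' z' \<theta>'. generating_curve \<phi> a z0 I' x' z' \<theta>' \<longrightarrow> I \<subseteq> I' \<longrightarrow>
        (\<forall>s\<in>I. x' s = x s \<and> z' s = z s \<and> \<theta>' s = \<theta> s) \<longrightarrow> I' = I)"

end

theory Submission
  imports Defs
begin

text \<open>
  At a zero of \<open>cos \<theta>\<close> the equation for \<open>\<theta>\<close> forces \<open>(cos \<theta>)' = 1 / x\<close>, whose sign is that of \<open>s\<close>, so
  \<open>cos \<theta>\<close> never vanishes and the curve is the graph of \<open>u = z \<circ> x\<^sup>-\<^sup>1\<close>, which solves the singular graph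
  equation. Conversely every extension of \<open>u\<close> yields, through its arc length, an extension of the
  curve, so \<open>u\<close> is maximal.

  For two solutions \<open>u\<close>, \<open>v\<close> the singular term \<open>-(u' - v') / x\<close> only decreases
  \<open>(u - v)\<^sup>2 + (u' - v')\<^sup>2\<close> for \<open>x > 0\<close>, and Gronwall's argument gives uniqueness; comparing \<open>u\<close> with its
  reflection shows that the domain is symmetric and \<open>u\<close> even. The function \<open>g = \<phi>'(u) - u' / x\<close> starts
  at \<open>\<phi>'(z0) / 2 > 0\<close> and has positive derivative wherever it vanishes, hence \<open>u'' > 0\<close> and
  \<open>u' < x \<phi>'(u)\<close>. If \<open>u\<close> stayed bounded up to a finite end point, so would \<open>u'\<close>; both being monotone,
  they would converge and \<open>u\<close> could be continued.
\<close>

section \<open>Calculus on intervals\<close>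

text \<open>Openness keeps both end points out, and the interval property fills everything between
  them. This form with extended end points is what the antiderivative below and the final statement
  require.\<close>

lemma einterval_Inf_Sup:
  fixes K :: "real set"
  assumes "open K" and "is_interval K" and "K \<noteq> {}"
  shows "K = einterval (INF x\<in>K. ereal x) (SUP x\<in>K. ereal x)"
proof (intro set_eqI iffI)
  fix t assume "t \<in> K"
  then obtain e where e: "e > 0" "cball t e \<subseteq> K"
    using assms(1) open_contains_cball by blast
  then have "t - e \<in> K" "t + e \<in> K"
    by (auto simp: subset_iff dist_real_def)
  then have "(INF x\<in>K. ereal x) \<le> ereal (t - e)" "ereal (t + e) \<le> (SUP x\<in>K. ereal x)"
    by (auto intro: INF_lower SUP_upper)
  moreover have "ereal (t - e) < ereal t" "ereal t < ereal (t + e)"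
    using e(1) by simp_all
  ultimately show "t \<in> einterval (INF x\<in>K. ereal x) (SUP x\<in>K. ereal x)"
    unfolding einterval_iff by (metis le_less_trans less_le_trans)
next
  fix t assume "t \<in> einterval (INF x\<in>K. ereal x) (SUP x\<in>K. ereal x)"
  then have "\<exists>c\<in>K. c < t" "\<exists>d\<in>K. t < d"
    unfolding einterval_iff INF_less_iff less_SUP_iff by simp_all
  then obtain c d where "c \<in> K" "c < t" "d \<in> K" "t < d"
    by blast
  then show "t \<in> K"
    using mem_is_interval_1_I[OF assms(2), of c d t] by simp
qed

text \<open>Serves to define the arc length of a graph over a possibly unbounded interval.\<close>

lemma antiderivative_on_open_interval:
  fixes f :: "real \<Rightarrow> real"
  assumes "open K" and "is_interval K" and "K \<noteq> {}" and "continuous_on K f"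
  obtains F where "\<And>x. x \<in> K \<Longrightarrow> (F has_real_derivative f x) (at x)"
proof -
  define l r where "l = (INF x\<in>K. ereal x)" and "r = (SUP x\<in>K. ereal x)"
  have K: "K = einterval l r"
    unfolding l_def r_def by (rule einterval_Inf_Sup) fact+
  with assms(3) have "l < r"
    by (auto simp: einterval_iff intro: less_trans)
  moreover have "isCont f x" if "l < ereal x" "ereal x < r" for x
    using that assms(1,4) K by (auto simp: einterval_iff continuous_on_eq_continuous_at)
  ultimately obtain F where "\<forall>x. l < ereal x \<longrightarrow> ereal x < r \<longrightarrow> (F has_vector_derivative f x) (at x)"
    using einterval_antiderivative[of l r f] by blast
  with that show thesis
    by (auto simp: K einterval_iff has_real_derivative_iff_has_vector_derivative)
qed

text \<open>A positive derivative makes \<open>f\<close> strictly increasing, invariance of domain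
  makes the image open, and the inverse function rule does the rest. It is applied to the abscissa
  of a curve as a function of arc length, and to the arc length as a function of the
  abscissa.\<close>

lemma inverse_on_open_interval:
  fixes f f' :: "real \<Rightarrow> real"
  assumes "open K" and "is_interval K"
    and deriv: "\<And>x. x \<in> K \<Longrightarrow> (f has_real_derivative f' x) (at x)"
    and pos: "\<And>x. x \<in> K \<Longrightarrow> f' x > 0"
  obtains g where "open (f ` K)" "is_interval (f ` K)" "\<And>x. x \<in> K \<Longrightarrow> g (f x) = x"
    "\<And>x. x \<in> K \<Longrightarrow> (g has_real_derivative inverse (f' x)) (at (f x))"
proof
  have less: "f x < f y" if "x \<in> K" "y \<in> K" "x < y" for x y
  proof (rule DERIV_pos_imp_increasing[OF that(3)])
    fix t assume "x \<le> t" "t \<le> y"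
    then have "t \<in> K" using mem_is_interval_1_I[OF assms(2) that(1,2)] by blast
    then show "\<exists>y. (f has_real_derivative y) (at t) \<and> 0 < y" using deriv pos by blast
  qed
  have inj: "inj_on f K"
    by (rule linorder_inj_onI') (metis less less_irrefl)
  have cont: "continuous_on K f"
    by (meson deriv DERIV_isCont continuous_at_imp_continuous_on)
  show "open (f ` K)"
    using cont assms(1) inj by (rule invariance_of_domain)
  show "is_interval (f ` K)"
    using connected_continuous_image[OF cont] assms(2) by (simp add: is_interval_connected_1)
  show inv: "inv_into K f (f x) = x" if "x \<in> K" for x
    using inj that by simp
  show "(inv_into K f has_real_derivative inverse (f' x)) (at (f x))" if "x \<in> K" for x
    unfolding has_field_derivative_def
  proof (rule has_derivative_inverse_on[OF assms(1), where f' = "\<lambda>x. (*) (f' x)"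
        and g' = "\<lambda>x. (*) (inverse (f' x))"])
    show "(*) (f' x) \<circ> (*) (inverse (f' x)) = id"
      using pos[OF that] by (auto simp: fun_eq_iff)
  qed (use that deriv inv in \<open>auto simp: has_field_derivative_def\<close>)
qed

text \<open>First-zero argument: at the first point where positivity fails the function vanishes,
  and a positive derivative there would make it negative just before. All sign statements about cos
  \<theta>, u'/x and \<phi>'(u) - u'/x come from here.\<close>

lemma positive_if_increasing_at_zeros:
  fixes f f' :: "real \<Rightarrow> real"
  assumes cont: "continuous_on {0..b} f" and "f 0 > 0"
    and deriv: "\<And>x. 0 < x \<Longrightarrow> x \<le> b \<Longrightarrow> (f has_real_derivative f' x) (at x)"
    and zero: "\<And>x. 0 < x \<Longrightarrow> x \<le> b \<Longrightarrow> f x = 0 \<Longrightarrow> f' x > 0"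
    and "t \<in> {0..b}"
  shows "f t > 0"
proof (rule ccontr)
  assume "\<not> f t > 0"
  define Z where "Z = {0..b} \<inter> f -` {..0}"
  have "compact Z"
    unfolding Z_def using continuous_closed_preimage[OF cont closed_atLeastAtMost closed_atMost]
      compact_Int_closed[OF compact_Icc] by (metis Int_absorb1 Int_lower1)
  moreover have "t \<in> Z"
    using assms(5) \<open>\<not> f t > 0\<close> by (auto simp: Z_def)
  ultimately obtain m where m: "m \<in> Z" "\<And>s. s \<in> Z \<Longrightarrow> m \<le> s"
    using compact_attains_inf[of Z] by auto
  then have before: "f s > 0" if "0 \<le> s" "s < m" for s
    using that by (force simp: Z_def)
  have "m > 0"
    using m(1) \<open>f 0 > 0\<close> by (cases "m = 0") (auto simp: Z_def)
  \<comment> \<open>A negative value at \<open>m\<close> would produce a zero strictly before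
    \<open>m\<close> by the intermediate value theorem.\<close>
  have "f m = 0"
  proof (rule ccontr)
    assume "f m \<noteq> 0"
    then have "f m < 0" using m(1) by (auto simp: Z_def)
    moreover have "continuous_on {0..m} f"
      using m(1) by (intro continuous_on_subset[OF cont]) (auto simp: Z_def)
    ultimately obtain s where "0 \<le> s" "s \<le> m" "f s = 0"
      using IVT2'[of f m 0 0] \<open>f 0 > 0\<close> \<open>m > 0\<close> by auto
    with before[of s] \<open>f m < 0\<close> show False by (cases "s = m") auto
  qed
  then have "f' m > 0" "(f has_real_derivative f' m) (at m)"
    using zero deriv \<open>m > 0\<close> m(1) by (auto simp: Z_def)
  then obtain d where d: "d > 0" "\<And>h. 0 < h \<Longrightarrow> h < d \<Longrightarrow> f (m - h) < f m"
    using DERIV_pos_inc_left by blast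
  define h where "h = min (d / 2) m"
  have "0 < h" "h < d" "h \<le> m" using d(1) \<open>m > 0\<close> by (auto simp: h_def)
  with d(2)[of h] before[of "m - h"] \<open>f m = 0\<close> show False by auto
qed

text \<open>By the mean value theorem each difference quotient at \<open>c\<close> is a value of
  \<open>f'\<close> at a point between. This recovers the derivative at the singular point s = 0
  and, later, at the point where two solutions are glued.\<close>

lemma has_real_derivative_if_tendsto:
  fixes f f' :: "real \<Rightarrow> real"
  assumes "open S" and "c \<in> S" and "continuous_on S f"
    and deriv: "\<And>x. x \<in> S \<Longrightarrow> x \<noteq> c \<Longrightarrow> (f has_real_derivative f' x) (at x)"
    and lim: "(f' \<longlongrightarrow> l) (at c)"
  shows "(f has_real_derivative l) (at c)"
  unfolding has_field_derivative_iff
proof (rule LIM_I)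
  fix e :: real assume "e > 0"
  then obtain d where d: "d > 0" "\<And>y. y \<noteq> c \<Longrightarrow> norm (y - c) < d \<Longrightarrow> norm (f' y - l) < e"
    using LIM_D[OF lim] by blast
  obtain d' where d': "d' > 0" "ball c d' \<subseteq> S"
    using assms(1,2) open_contains_ball by blast
  have "norm ((f y - f c) / (y - c) - l) < e" if "y \<noteq> c" "norm (y - c) < min d d'" for y
  proof -
    let ?a = "min y c" and ?b = "max y c"
    have ab: "?a < ?b" using that(1) by auto
    have inS: "{?a..?b} \<subseteq> S"
      using that(2) d'(2) by (force simp: subset_iff dist_real_def)
    obtain \<xi> where \<xi>: "?a < \<xi>" "\<xi> < ?b" "f ?b - f ?a = (?b - ?a) * f' \<xi>"
    proof (rule MVT[OF ab, of f, THEN exE])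
      show "continuous_on {?a..?b} f"
        using assms(3) inS by (rule continuous_on_subset)
      show "f differentiable (at x)" if "?a < x" "x < ?b" for x
      proof -
        have "x \<in> S" "x \<noteq> c" using that inS by (auto simp: subset_iff)
        then show ?thesis using deriv real_differentiable_def by blast
      qed
    next
      fix l' assume "\<exists>\<xi>>?a. \<xi> < ?b \<and> (f has_real_derivative l') (at \<xi>) \<and> f ?b - f ?a = (?b - ?a) * l'"
      then obtain \<xi> where \<xi>: "?a < \<xi>" "\<xi> < ?b" "(f has_real_derivative l') (at \<xi>)"
        "f ?b - f ?a = (?b - ?a) * l'" by blast
      have "l' = f' \<xi>"
        using \<xi> inS by (intro DERIV_unique[OF \<xi>(3) deriv]) (auto simp: subset_iff)
      with \<xi> that show thesis by blast
    qed
    have "(f y - f c) / (y - c) = f' \<xi>"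
      using \<xi>(3) that(1) by (auto simp: min_def max_def field_simps split: if_splits)
    moreover have "norm (f' \<xi> - l) < e"
      using \<xi> that by (intro d(2)) (auto simp: min_def max_def split: if_splits)
    ultimately show ?thesis by simp
  qed
  then show "\<exists>s>0. \<forall>x. x \<noteq> c \<and> norm (x - c) < s \<longrightarrow> norm ((f x - f c) / (x - c) - l) < e"
    using d(1) d'(1) by (intro exI[of _ "min d d'"]) auto
qed

section \<open>Local existence for ordinary differential equations\<close>

text \<open>Banach's fixed point theorem for the Picard operator, run in the space of bounded
  continuous functions on the whole line with values in the closed ball.\<close>

lemma picard_local_existence:
  fixes f :: "real \<Rightarrow> 'a::euclidean_space \<Rightarrow> 'a"
  assumes "t0 < t1" and "r > 0"
    and cont: "continuous_on ({t0..t1} \<times> cball y0 r) (\<lambda>(t, y). f t y)"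
    and lip: "\<And>t y y'. t \<in> {t0..t1} \<Longrightarrow> y \<in> cball y0 r \<Longrightarrow> y' \<in> cball y0 r \<Longrightarrow>
       norm (f t y - f t y') \<le> C * norm (y - y')"
  obtains t2 y where "t0 < t2" "t2 \<le> t1" "y t0 = y0" "y ` {t0..t2} \<subseteq> cball y0 r"
    "\<And>t. t \<in> {t0..t2} \<Longrightarrow> (y has_vector_derivative f t (y t)) (at t within {t0..t2})"
proof -
  have "compact ((\<lambda>(t, y). f t y) ` ({t0..t1} \<times> cball y0 r))"
    using cont by (rule compact_continuous_image) (simp add: compact_Times)
  then have "bounded ((\<lambda>(t, y). f t y) ` ({t0..t1} \<times> cball y0 r))"
    by (rule compact_imp_bounded)
  then obtain B where B0: "B > 0" and
      "\<forall>v \<in> (\<lambda>(t, y). f t y) ` ({t0..t1} \<times> cball y0 r). norm v \<le> B"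
    unfolding bounded_pos by blast
  then have B: "norm (f t y) \<le> B" if "t \<in> {t0..t1}" "y \<in> cball y0 r" for t y
    using that by fast
  define C' where "C' = max C 1"
  have C': "C' > 0" "C \<le> C'" by (auto simp: C'_def)
  \<comment> \<open>The bound r / B keeps Picard iterates inside the ball, and 1 / (2 C') makes the
    operator contract by 1/2. Taking \<open>C'\<close> at least 1 keeps the division legitimate
    whatever \<open>C\<close> is.\<close>
  define \<epsilon> where "\<epsilon> = min (t1 - t0) (min (r / B) (1 / (2 * C')))"
  have "\<epsilon> \<le> r / B" "\<epsilon> \<le> 1 / (2 * C')"
    by (auto simp: \<epsilon>_def)
  then have \<epsilon>: "\<epsilon> > 0" "\<epsilon> \<le> t1 - t0" "\<epsilon> * B \<le> r" "\<epsilon> * C' \<le> 1 / 2"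
    using assms(1,2) B0 C'(1) by (auto simp: \<epsilon>_def pos_le_divide_eq mult_ac)
  define t2 where "t2 = t0 + \<epsilon>"
  have t2: "t0 < t2" "t2 \<le> t1" using \<epsilon> by (auto simp: t2_def)
  \<comment> \<open>A closed set of bounded continuous functions, hence complete in the sup
    metric.\<close>
  define M :: "(real \<Rightarrow>\<^sub>C 'a) set" where "M = PiC UNIV (\<lambda>_. cball y0 r)"
  have M: "g \<in> M \<longleftrightarrow> (\<forall>t. apply_bcontfun g t \<in> cball y0 r)" for g
    by (auto simp: M_def mem_PiC_iff)
  have cont_comp: "continuous_on {t0..t2} (\<lambda>s. f s (apply_bcontfun g s))" if "g \<in> M" for g
  proof -
    have "continuous_on {t0..t2} ((\<lambda>(t, y). f t y) \<circ> (\<lambda>s. (s, apply_bcontfun g s)))"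
      using that t2 by (intro continuous_on_compose continuous_intros
         continuous_on_subset[OF cont]) (auto simp: M)
    then show ?thesis by (simp add: o_def)
  qed
  define P where "P g t = y0 + integral {t0..t} (\<lambda>s. f s (apply_bcontfun g s))" for g t
  have P_deriv: "(P g has_vector_derivative f t (apply_bcontfun g t)) (at t within {t0..t2})"
    if "g \<in> M" "t \<in> {t0..t2}" for g t
    unfolding P_def using integral_has_vector_derivative[OF cont_comp[OF that(1)] that(2)]
    by (auto intro!: derivative_eq_intros)
  \<comment> \<open>Elements of \<open>M\<close> live on all of \<real>, so the Picard integral is
    frozen at its end values outside the time interval by clamping.\<close>
  have "\<exists>h. \<forall>t. apply_bcontfun h t = P g (clamp t0 t2 t)" if "g \<in> M" for g
  proof -
    have "continuous_on (cbox t0 t2) (P g)"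
      unfolding cbox_interval using P_deriv[OF that] by (rule continuous_on_vector_derivative)
    then show ?thesis
      by (rule continuous_on_cbox_bcontfunE) blast
  qed
  then obtain T where T: "\<And>g t. g \<in> M \<Longrightarrow> apply_bcontfun (T g) t = P g (clamp t0 t2 t)"
    by metis
  have clamp: "clamp t0 t2 t \<in> {t0..t2}" for t
    using clamp_in_interval[of t0 t2 t] t2 by (auto simp: cbox_interval)
  have intg: "(\<lambda>s. f s (apply_bcontfun g s)) integrable_on {t0..t}" if "g \<in> M" "t \<in> {t0..t2}" for g t
    using that by (intro integrable_continuous_real continuous_on_subset[OF cont_comp[OF that(1)]]) auto
  have "\<exists>!g\<in>M. T g = g"
  proof (rule Banach_fix[where c = "1 / 2"])
    show "complete M"
      unfolding M_def by (intro closed_PiC complete_eq_closed[THEN iffD2]) auto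
    have "const_bcontfun y0 \<in> M"
      using assms(2) by (auto simp: M const_bcontfun.rep_eq)
    then show "M \<noteq> {}" by blast
    show "T ` M \<subseteq> M"
    proof clarify
      fix g assume g: "g \<in> M"
      have "norm (P g t - y0) \<le> r" if t: "t \<in> {t0..t2}" for t
      proof -
        have "norm (P g t - y0) \<le> B * (t - t0)"
          unfolding P_def using t t2 g B 
          by (auto simp: M intro!: integral_bound cont_comp[OF g, THEN continuous_on_subset])
        also have "\<dots> \<le> B * \<epsilon>" using t B0 by (intro mult_left_mono) (auto simp: t2_def)
        finally show ?thesis using \<epsilon>(3) by (simp add: mult.commute)
      qed
      then show "T g \<in> M"
        using clamp by (auto simp: M T[OF g] dist_norm norm_minus_commute)
    qed
    fix g h assume gh: "g \<in> M" "h \<in> M"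
    show "dist (T g) (T h) \<le> 1 / 2 * dist g h"
    proof (rule dist_bound)
      fix t' :: real
      define t where "t = clamp t0 t2 t'"
      have t: "t \<in> {t0..t2}" using clamp by (simp add: t_def)
      have "norm (P g t - P h t) = norm (integral {t0..t} (\<lambda>s. f s (apply_bcontfun g s) - f s (apply_bcontfun h s)))"
        using intg[OF gh(1) t] intg[OF gh(2) t] by (simp add: P_def integral_diff)
      also have "\<dots> \<le> (C' * dist g h) * (t - t0)"
      proof (rule integral_bound)
        show "continuous_on {t0..t} (\<lambda>s. f s (apply_bcontfun g s) - f s (apply_bcontfun h s))"
          using t by (intro continuous_on_diff continuous_on_subset[OF cont_comp] gh) auto
        fix s assume s: "s \<in> {t0..t}"
        have "norm (f s (apply_bcontfun g s) - f s (apply_bcontfun h s)) \<le> C * norm (apply_bcontfun g s - apply_bcontfun h s)"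
          using gh s t t2 by (intro lip) (auto simp: M)
        also have "\<dots> \<le> C' * dist g h"
          using C' dist_bounded[of g s h] by (intro mult_mono) (auto simp: dist_norm)
        finally show "norm (f s (apply_bcontfun g s) - f s (apply_bcontfun h s)) \<le> C' * dist g h" .
      qed (use t in auto)
      also have "\<dots> \<le> (C' * dist g h) * \<epsilon>"
        using t C' by (intro mult_left_mono) (auto simp: t2_def)
      also have "\<dots> \<le> 1 / 2 * dist g h"
        using mult_right_mono[OF \<epsilon>(4), of "dist g h"] by (simp add: mult_ac)
      finally show "dist (apply_bcontfun (T g) t') (apply_bcontfun (T h) t') \<le> 1 / 2 * dist g h"
        by (simp add: T gh t_def dist_norm)
    qed
  qed auto
  then obtain g where g: "g \<in> M" "T g = g" by blast
  have eq: "apply_bcontfun g t = P g t" if "t \<in> {t0..t2}" for t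
    using T[OF g(1), of t] g(2) that by (simp add: cbox_interval)
  show thesis
  proof
    show "t0 < t2" "t2 \<le> t1" by fact+
    show "apply_bcontfun g t0 = y0" using eq[of t0] t2 by (simp add: P_def)
    show "apply_bcontfun g ` {t0..t2} \<subseteq> cball y0 r" using g(1) by (auto simp: M)
    fix t assume t: "t \<in> {t0..t2}"
    show "(apply_bcontfun g has_vector_derivative f t (apply_bcontfun g t)) (at t within {t0..t2})"
      by (rule has_vector_derivative_transform[OF t _ P_deriv[OF g(1) t]]) (simp add: eq)
  qed
qed

section \<open>Convexity of solutions of the graph equation\<close>

lemma einterval_upward: "c \<in> einterval a \<infinity> \<Longrightarrow> c \<le> t \<Longrightarrow> t \<in> einterval a \<infinity>"
  by (auto simp: einterval_iff intro: less_le_trans[of a "ereal c" "ereal t"])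

lemma DERIV_minus_mirror:
  fixes f :: "real \<Rightarrow> real"
  assumes "(f has_real_derivative D) (at (- x))"
  shows "((\<lambda>x. - f (- x)) has_real_derivative D) (at x)"
  using DERIV_minus[of "\<lambda>x. f (- x)" "- D" x UNIV] assms by (simp add: DERIV_mirror)

lemma C2_onI:
  assumes "open S" and f: "\<And>x. x \<in> S \<Longrightarrow> (f has_vector_derivative p x) (at x)"
    and p: "\<And>x. x \<in> S \<Longrightarrow> (p has_vector_derivative q x) (at x)"
    and "continuous_on S q"
  shows "C2_on f S"
proof -
  have "((\<lambda>t. vector_derivative f (at t)) has_vector_derivative q x) (at x)" if "x \<in> S" for x
    using p[OF that] assms(1) that
    by (rule has_vector_derivative_transform_within_open) (simp add: f[THEN vector_derivative_at])
  moreover have "continuous_on S p"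
    by (meson p has_vector_derivative_continuous continuous_at_imp_continuous_on)
  ultimately show ?thesis
    unfolding C2_on_def C1_differentiable_on_def using f assms(4) by blast
qed

lemma C2_onD:
  assumes "C2_on f S"
  shows "x \<in> S \<Longrightarrow> (f has_vector_derivative vector_derivative f (at x)) (at x)"
    and "x \<in> S \<Longrightarrow> ((\<lambda>t. vector_derivative f (at t)) has_vector_derivative
       vector_derivative (\<lambda>t. vector_derivative f (at t)) (at x)) (at x)"
    and "continuous_on S (\<lambda>x. vector_derivative (\<lambda>t. vector_derivative f (at t)) (at x))"
  using assms unfolding C2_on_def C1_differentiable_on_eq vector_derivative_works by auto

text \<open>Candidates \<open>p\<close> and \<open>q\<close> for the first two derivatives suffice:
  on an open set they coincide with the iterated \<open>deriv\<close>, which then need not be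
  computed in each application.\<close>

lemma graph_solutionI:
  assumes "open_interval_at_0 J"
    and u: "\<And>x. x \<in> J \<Longrightarrow> (u has_real_derivative p x) (at x)"
    and p: "\<And>x. x \<in> J \<Longrightarrow> (p has_real_derivative q x) (at x)"
    and "continuous_on J q" and "u ` J \<subseteq> einterval a \<infinity>" and "u 0 = z0" and "p 0 = 0"
    and q: "\<And>x. x \<in> J \<Longrightarrow> x \<noteq> 0 \<Longrightarrow> q x = (1 + (p x)\<^sup>2) * (deriv \<phi> (u x) - p x / x)"
  shows "graph_solution \<phi> a z0 J u"
proof -
  have J: "open J" "0 \<in> J" using assms(1) by (auto simp: open_interval_at_0_def)
  have d1: "deriv u x = p x" if "x \<in> J" for x
    using u[OF that] by (rule DERIV_imp_deriv)
  have d2: "deriv (deriv u) x = q x" if "x \<in> J" for x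
    by (rule DERIV_imp_deriv[OF has_field_derivative_transform_within_open[OF p[OF that] J(1) that]])
      (simp add: d1)
  have "C2_on u J"
    using J(1) u p assms(4) unfolding has_real_derivative_iff_has_vector_derivative by (rule C2_onI)
  with assms(1,5-8) J(2) show ?thesis
    by (auto simp: graph_solution_def d1 d2)
qed

lemma graph_solutionD:
  assumes "graph_solution \<phi> a z0 J u"
  shows "open J" "is_interval J" "0 \<in> J" "u 0 = z0" "deriv u 0 = 0"
    and "x \<in> J \<Longrightarrow> u x \<in> einterval a \<infinity>"
    and "x \<in> J \<Longrightarrow> (u has_real_derivative deriv u x) (at x)"
    and "x \<in> J \<Longrightarrow> (deriv u has_real_derivative deriv (deriv u) x) (at x)"
    and "continuous_on J (deriv (deriv u))"
    and "x \<in> J \<Longrightarrow> x \<noteq> 0 \<Longrightarrow>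
      deriv (deriv u) x = (1 + (deriv u x)\<^sup>2) * (deriv \<phi> (u x) - deriv u x / x)"
  using assms C2_onD[of u J]
  by (auto simp: graph_solution_def open_interval_at_0_def has_real_derivative_iff_has_vector_derivative
      field_derivative_eq_vector_derivative[abs_def])

lemma graph_solution_continuous:
  assumes "graph_solution \<phi> a z0 J u"
  shows "continuous_on J u" and "continuous_on J (deriv u)"
  by (meson graph_solutionD(7,8)[OF assms] DERIV_isCont continuous_at_imp_continuous_on)+

text \<open>Under x \<mapsto> -x the slope u' changes sign while u'/x, u'^2 and u'' do not, so the
  equation is preserved.\<close>

lemma graph_solution_reflect:
  assumes "graph_solution \<phi> a z0 J u"
  shows "graph_solution \<phi> a z0 (uminus ` J) (\<lambda>x. u (- x))"
proof (rule graph_solutionI[where p = "\<lambda>x. - deriv u (- x)" and q = "\<lambda>x. deriv (deriv u) (- x)"])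
  note D = graph_solutionD[OF assms]
  have J: "x \<in> uminus ` J \<longleftrightarrow> - x \<in> J" for x
    by (metis (no_types, lifting) add.inverse_inverse image_iff)
  have "is_interval (uminus ` J)"
    using D(2) by (simp add: is_interval_uminus)
  then show "open_interval_at_0 (uminus ` J)"
    using D(1,3) open_negations[of J] by (auto simp: open_interval_at_0_def J)
  fix x assume x: "x \<in> uminus ` J"
  show "((\<lambda>x. u (- x)) has_real_derivative - deriv u (- x)) (at x)"
    using D(7)[of "- x"] x by (simp add: J DERIV_mirror)
  show "((\<lambda>x. - deriv u (- x)) has_real_derivative deriv (deriv u) (- x)) (at x)"
    using x by (intro DERIV_minus_mirror D(8)) (simp add: J)
  show "deriv (deriv u) (- x) = (1 + (- deriv u (- x))\<^sup>2) * (deriv \<phi> (u (- x)) - - deriv u (- x) / x)"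
    if "x \<noteq> 0" using D(10)[of "- x"] x that by (simp add: J)
next
  note D = graph_solutionD[OF assms]
  show "continuous_on (uminus ` J) (\<lambda>x. deriv (deriv u) (- x))"
    by (rule continuous_on_compose2[OF D(9)]) (auto intro: continuous_intros)
  show "(\<lambda>x. u (- x)) ` uminus ` J \<subseteq> einterval a \<infinity>" "u (- 0) = z0" "- deriv u (- 0) = 0"
    using D(4-6) by auto
qed

text \<open>The regularity and sign conditions under which all estimates are run. Nonnegativity of
  the second derivative enters through the monotonicity of \<phi>' and through the sign of
  (\<phi>'(u))'.\<close>

locale weight =
  fixes \<phi> :: "real \<Rightarrow> real" and a :: ereal
  assumes deriv2: "t \<in> einterval a \<infinity> \<Longrightarrow> (deriv \<phi> has_real_derivative deriv (deriv \<phi>) t) (at t)"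
    and deriv2_cont: "continuous_on (einterval a \<infinity>) (deriv (deriv \<phi>))"
    and deriv_pos: "t \<in> einterval a \<infinity> \<Longrightarrow> deriv \<phi> t > 0"
    and deriv2_nonneg: "t \<in> einterval a \<infinity> \<Longrightarrow> deriv (deriv \<phi>) t \<ge> 0"
begin

lemma deriv_isCont: "t \<in> einterval a \<infinity> \<Longrightarrow> isCont (deriv \<phi>) t"
  using deriv2 DERIV_isCont by blast

lemma deriv_cont: "continuous_on (einterval a \<infinity>) (deriv \<phi>)"
  by (simp add: continuous_at_imp_continuous_on deriv_isCont)

lemma deriv_mono:
  assumes "s \<in> einterval a \<infinity>" and "s \<le> t"
  shows "deriv \<phi> s \<le> deriv \<phi> t"
proof (rule DERIV_nonneg_imp_nondecreasing[OF assms(2)])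
  fix r assume "s \<le> r"
  then have "r \<in> einterval a \<infinity>"
    by (rule einterval_upward[OF assms(1)])
  then show "\<exists>d. (deriv \<phi> has_real_derivative d) (at r) \<and> 0 \<le> d"
    using deriv2 deriv2_nonneg by blast
qed

text \<open>The continuous function \<phi>'' is bounded on a compact interval. The constant feeds
  both the Gronwall estimate and the Picard iteration.\<close>

lemma deriv_lipschitz:
  assumes "c \<in> einterval a \<infinity>"
  obtains C where "C \<ge> 0"
    "\<And>s t. s \<in> {c..d} \<Longrightarrow> t \<in> {c..d} \<Longrightarrow> \<bar>deriv \<phi> s - deriv \<phi> t\<bar> \<le> C * \<bar>s - t\<bar>"
proof -
  have sub: "{c..d} \<subseteq> einterval a \<infinity>"
    using einterval_upward[OF assms] by auto
  have "bounded (deriv (deriv \<phi>) ` {c..d})"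
    by (intro compact_imp_bounded compact_continuous_image continuous_on_subset[OF deriv2_cont sub]) simp
  then obtain C where C: "C > 0" "\<forall>x\<in>{c..d}. norm (deriv (deriv \<phi>) x) \<le> C"
    unfolding bounded_pos by auto
  have "norm (deriv \<phi> s - deriv \<phi> t) \<le> C * norm (s - t)" if "s \<in> {c..d}" "t \<in> {c..d}" for s t
  proof (rule field_differentiable_bound[of "{c..d}" "deriv \<phi>" "deriv (deriv \<phi>)"])
    show "(deriv \<phi> has_field_derivative deriv (deriv \<phi>) z) (at z within {c..d})" if "z \<in> {c..d}" for z
      using deriv2[of z] sub that by (blast intro: has_field_derivative_at_within)
  qed (use C that in auto)
  with that[of C] C(1) show thesis by auto
qed

text \<open>Since u'(0) = 0, the quotient u'/x tends to u''(0). Letting x tend to 0 in the equation,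
  with u'' continuous, gives u''(0) = \<phi>'(z0) - u''(0).\<close>

lemma graph_solution_slope_tendsto:
  assumes "graph_solution \<phi> a z0 J u"
  shows "((\<lambda>x. deriv u x / x) \<longlongrightarrow> deriv \<phi> z0 / 2) (at 0)"
proof -
  note D = graph_solutionD[OF assms]
  have slope: "((\<lambda>x. deriv u x / x) \<longlongrightarrow> deriv (deriv u) 0) (at 0)"
    using D(8)[OF D(3)] D(5) by (simp add: has_field_derivative_iff)
  have "(deriv \<phi> \<longlongrightarrow> deriv \<phi> z0) (at z0)"
    using deriv_isCont[of z0] D(4) D(6)[OF D(3)] by (simp add: isCont_def)
  have tend: "isCont u 0" "isCont (deriv u) 0"
    using D(7,8)[OF D(3)] DERIV_isCont by blast+
  have "isCont (\<lambda>x. deriv \<phi> (u x)) 0"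
    by (rule isCont_o2[OF tend(1)]) (use deriv_isCont D(6)[OF D(3)] in simp)
  then have "((\<lambda>x. (1 + (deriv u x)\<^sup>2) * (deriv \<phi> (u x) - deriv u x / x))
      \<longlongrightarrow> (1 + (deriv u 0)\<^sup>2) * (deriv \<phi> (u 0) - deriv (deriv u) 0)) (at 0)"
    using tend by (intro tendsto_intros slope) (auto simp: isCont_def)
  moreover have "\<forall>\<^sub>F x in at 0. deriv (deriv u) x =
      (1 + (deriv u x)\<^sup>2) * (deriv \<phi> (u x) - deriv u x / x)"
    using eventually_at_in_open[OF D(1,3)] by eventually_elim (use D(10) in auto)
  ultimately have "(deriv (deriv u) \<longlongrightarrow> (1 + (deriv u 0)\<^sup>2) * (deriv \<phi> (u 0) - deriv (deriv u) 0)) (at 0)"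
    by (simp add: tendsto_cong)
  moreover have "(deriv (deriv u) \<longlongrightarrow> deriv (deriv u) 0) (at 0)"
    using D(1,3,9) by (metis continuous_on_eq_continuous_at isCont_def)
  ultimately have "(1 + (deriv u 0)\<^sup>2) * (deriv \<phi> (u 0) - deriv (deriv u) 0) = deriv (deriv u) 0"
    using tendsto_unique trivial_limit_at by blast
  then have "deriv (deriv u) 0 = deriv \<phi> z0 / 2"
    by (simp add: D(4,5))
  with slope show ?thesis by simp
qed

text \<open>Two first-zero arguments, one for u'/x and one for \<phi>'(u) - u'/x. The second bound
  says exactly that the right-hand side of the equation is positive.\<close>

lemma graph_solution_slope_bounds:
  assumes u: "graph_solution \<phi> a z0 J u" and "b \<in> J" and "b > 0"
  shows "deriv u b > 0" and "deriv u b < b * deriv \<phi> (u b)"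
proof -
  note D = graph_solutionD[OF u]
  define L where "L = deriv \<phi> z0 / 2"
  have "z0 \<in> einterval a \<infinity>" using D(3,4,6) by blast
  then have "L > 0" using deriv_pos by (simp add: L_def)
  have sub: "x \<in> J" if "0 \<le> x" "x \<le> b" for x
    using mem_is_interval_1_I[OF D(2,3) assms(2)] that .
  \<comment> \<open>The value at 0 is the limit of u'/x, so that \<open>f\<close> is continuous up
    to the singular point and starts positive.\<close>
  define f where "f x = (if x = 0 then L else deriv u x / x)" for x
  define g where "g x = deriv \<phi> (u x) - f x" for x
  have f_deriv: "(f has_real_derivative (deriv (deriv u) x - f x) / x) (at x)" if "0 < x" "x \<le> b" for x
  proof (rule has_field_derivative_transform_within_open[of "\<lambda>x. deriv u x / x" _ _ "{0<..}"])
    show "((\<lambda>x. deriv u x / x) has_real_derivative (deriv (deriv u) x - f x) / x) (at x)"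
      using that D(8)[OF sub] by (auto intro!: derivative_eq_intros simp: f_def divide_simps)
  qed (use that in \<open>auto simp: f_def\<close>)
  have "(f \<longlongrightarrow> L) (at 0)"
    using graph_solution_slope_tendsto[OF u] unfolding L_def
    by (rule Lim_transform_eventually) (auto simp: f_def eventually_at_filter)
  then have "isCont f 0"
    by (simp add: isCont_def f_def)
  then have "isCont f x" if "0 \<le> x" "x \<le> b" for x
    using f_deriv[of x] that DERIV_isCont by (cases "x = 0") force+
  then have f_cont: "continuous_on {0..b} f"
    by (simp add: continuous_at_imp_continuous_on)
  \<comment> \<open>At a zero of \<open>f\<close> the slope vanishes, so the equation reduces to u''
    = \<phi>'(u) > 0 and \<open>f\<close> increases.\<close>
  have f_pos: "f t > 0" if "t \<in> {0..b}" for t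
  proof (rule positive_if_increasing_at_zeros[OF f_cont _ f_deriv _ that])
    fix x assume x: "0 < x" "x \<le> b" "f x = 0"
    then have "x \<in> J" "deriv u x = 0" using sub by (auto simp: f_def)
    then have "deriv (deriv u) x > 0"
      using D(10)[of x] x deriv_pos[OF D(6)] by simp
    with x show "(deriv (deriv u) x - f x) / x > 0" by simp
  qed (use \<open>L > 0\<close> in \<open>auto simp: f_def\<close>)
  with assms(3) show "deriv u b > 0"
    using f_pos[of b] by (auto simp: f_def zero_less_divide_iff)
  have g_deriv: "(g has_real_derivative
      deriv (deriv \<phi>) (u x) * deriv u x - (deriv (deriv u) x - f x) / x) (at x)" if "0 < x" "x \<le> b" for x
    unfolding g_def using that D(6,7)[OF sub]
    by (intro DERIV_diff f_deriv DERIV_chain2[OF deriv2]) auto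
  have g_cont: "continuous_on {0..b} g"
    unfolding g_def using sub D(6)
    by (intro continuous_on_diff f_cont continuous_on_compose2[OF deriv_cont]
        continuous_on_subset[OF graph_solution_continuous(1)[OF u]]) auto
  \<comment> \<open>At a zero of \<open>g\<close> the equation gives u'' = 0, and the derivative of
    \<open>g\<close> becomes \<phi>''(u) u' + f/x, where the last term is positive.\<close>
  have "g b > 0"
  proof (rule positive_if_increasing_at_zeros[OF g_cont _ g_deriv])
    fix x assume x: "0 < x" "x \<le> b" "g x = 0"
    then have "deriv (deriv u) x = 0" "f x > 0" "deriv u x > 0"
      using D(10)[of x] sub f_pos[of x] by (auto simp: g_def f_def zero_less_divide_iff)
    moreover have "deriv (deriv \<phi>) (u x) \<ge> 0"
      using deriv2_nonneg D(6)[OF sub] x by simp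
    ultimately show "deriv (deriv \<phi>) (u x) * deriv u x - (deriv (deriv u) x - f x) / x > 0"
      using x by (simp add: add_nonneg_pos)
  qed (use \<open>L > 0\<close> D(4) assms(3) in \<open>auto simp: g_def f_def L_def\<close>)
  then show "deriv u b < b * deriv \<phi> (u b)"
    using assms(3) by (auto simp: g_def f_def field_simps)
qed

text \<open>For x > 0 this is the upper slope bound put into the equation, at 0 it is the limit of
  u'/x, and for x < 0 the reflected solution has the same second derivative.\<close>

lemma graph_solution_deriv2_pos:
  assumes u: "graph_solution \<phi> a z0 J u" and "x \<in> J"
  shows "deriv (deriv u) x > 0"
proof -
  have pos: "deriv (deriv v) t > 0" if v: "graph_solution \<phi> a z0 K v" and t: "t \<in> K" "t > 0" for K v t
  proof -
    have "deriv \<phi> (v t) - deriv v t / t > 0"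
      using graph_solution_slope_bounds(2)[OF v t] t(2) by (simp add: field_simps)
    moreover have "1 + (deriv v t)\<^sup>2 > 0" by (simp add: add_pos_nonneg)
    ultimately show ?thesis
      using graph_solutionD(10)[OF v t(1)] t(2) by simp
  qed
  note D = graph_solutionD[OF u]
  consider "x > 0" | "x = 0" | "x < 0" by linarith
  then show ?thesis
  proof cases
    case 1 with pos[OF u] assms(2) show ?thesis by simp
  next
    case 2
    have "((\<lambda>x. deriv u x / x) \<longlongrightarrow> deriv (deriv u) 0) (at 0)"
      using D(8)[OF D(3)] D(5) by (simp add: has_field_derivative_iff)
    then have "deriv (deriv u) 0 = deriv \<phi> z0 / 2"
      using graph_solution_slope_tendsto[OF u] tendsto_unique trivial_limit_at by blast
    with 2 show ?thesis using deriv_pos[OF D(6)[OF D(3)]] D(4) by simp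
  next
    case 3
    have d: "deriv (\<lambda>x. u (- x)) y = - deriv u (- y)" if "- y \<in> J" for y
      using D(7)[OF that] unfolding DERIV_mirror by (rule DERIV_imp_deriv)
    have "((\<lambda>y. - deriv u (- y)) has_real_derivative deriv (deriv u) x) (at (- x))"
      using D(8)[OF assms(2)] by (intro DERIV_minus_mirror) simp
    then have "(deriv (\<lambda>x. u (- x)) has_real_derivative deriv (deriv u) x) (at (- x))"
      by (rule has_field_derivative_transform_within_open[where S = "uminus ` J"])
        (use assms(2) d D(1) open_negations in auto)
    then have "deriv (deriv (\<lambda>x. u (- x))) (- x) = deriv (deriv u) x"
      by (rule DERIV_imp_deriv)
    with pos[OF graph_solution_reflect[OF u], of "- x"] assms(2) 3 show ?thesis by simp
  qed
qed

text \<open>The slope is strictly increasing, so the mean value slopes on the two sides of an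
  intermediate point are strictly ordered.\<close>

lemma graph_solution_strictly_convex:
  assumes u: "graph_solution \<phi> a z0 J u"
  shows "strictly_convex_on J u"
proof -
  note D = graph_solutionD[OF u]
  have sub: "t \<in> J" if "x \<in> J" "y \<in> J" "x \<le> t" "t \<le> y" for x y t
    using mem_is_interval_1_I[OF D(2)] that by blast
  have mono: "deriv u x < deriv u y" if "x \<in> J" "y \<in> J" "x < y" for x y
    using that(3) by (rule DERIV_pos_imp_increasing)
      (use sub[OF that(1,2)] D(8) graph_solution_deriv2_pos[OF u] in blast)
  have lt: "u ((1 - t) * x + t * y) < (1 - t) * u x + t * u y"
    if "x \<in> J" "y \<in> J" "x < y" "0 < t" "t < 1" for x y t
  proof -
    define m where "m = (1 - t) * x + t * y"
    have diffs: "m - x = t * (y - x)" "y - m = (1 - t) * (y - x)"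
      by (auto simp: m_def algebra_simps)
    have "m - x > 0" "y - m > 0" unfolding diffs using that by simp_all
    then have xm: "x < m" "m < y" by simp_all
    have "\<exists>\<xi>. x < \<xi> \<and> \<xi> < m \<and> u m - u x = (m - x) * deriv u \<xi>"
      using xm that sub[OF that(1,2)] D(7) by (intro MVT2) auto
    then obtain \<xi> where \<xi>: "x < \<xi>" "\<xi> < m" "u m - u x = (m - x) * deriv u \<xi>" by blast
    have "\<exists>\<eta>. m < \<eta> \<and> \<eta> < y \<and> u y - u m = (y - m) * deriv u \<eta>"
      using xm that sub[OF that(1,2)] D(7) by (intro MVT2) auto
    then obtain \<eta> where \<eta>: "m < \<eta>" "\<eta> < y" "u y - u m = (y - m) * deriv u \<eta>" by blast
    have "deriv u \<xi> < deriv u \<eta>"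
      using \<xi> \<eta> that by (intro mono sub[OF that(1,2)]) auto
    \<comment> \<open>This factor turns the two slopes into the increments weighted by 1 - t and t,
      since m - x = t(y - x) and y - m = (1 - t)(y - x).\<close>
    then have "(t * (1 - t) * (y - x)) * deriv u \<xi> < (t * (1 - t) * (y - x)) * deriv u \<eta>"
      using that by (intro mult_strict_left_mono) auto
    then have "(1 - t) * (u m - u x) < t * (u y - u m)"
      unfolding \<xi>(3) \<eta>(3) diffs by (simp add: mult_ac)
    then show ?thesis by (simp add: m_def algebra_simps)
  qed
  show ?thesis
    unfolding strictly_convex_on_def
  proof (intro conjI ballI allI impI)
    show "convex J" using D(2) by (rule is_interval_convex)
    fix x y t :: real
    assume "x \<in> J" "y \<in> J" "x \<noteq> y" "0 < t" "t < 1"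
    with lt[of x y t] lt[of y x "1 - t"]
    show "u ((1 - t) * x + t * y) < (1 - t) * u x + t * u y"
      by (cases "x < y") (auto simp: add.commute)
  qed
qed

end

section \<open>Uniqueness and symmetry\<close>

lemma open_interval_at_0_Un:
  assumes "open_interval_at_0 J" and "open_interval_at_0 K"
  shows "open_interval_at_0 (J \<union> K)"
  using assms connected_Un[of J K]
  by (auto simp: open_interval_at_0_def is_interval_connected_1)

text \<open>Every condition on a solution concerns the germ at a point, and agreement on an open set
  carries over to the first two derivatives. This is the tool for gluing; \<open>S\<close> is the
  neighbourhood of agreement and may miss 0 although \<open>K\<close> contains it.\<close>

lemma graph_solution_local:
  assumes J: "open_interval_at_0 J"
    and loc: "\<And>x. x \<in> J \<Longrightarrow> \<exists>K v S. graph_solution \<phi> a z0 K v \<and> x \<in> S \<and> open S \<and> S \<subseteq> K \<and> (\<forall>y\<in>S. u y = v y)"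
  shows "graph_solution \<phi> a z0 J u"
proof -
  have "(u has_real_derivative deriv u x) (at x) \<and>
      (deriv u has_real_derivative deriv (deriv u) x) (at x) \<and> isCont (deriv (deriv u)) x \<and>
      u x \<in> einterval a \<infinity> \<and> (x = 0 \<longrightarrow> u x = z0 \<and> deriv u x = 0) \<and>
      (x \<noteq> 0 \<longrightarrow> deriv (deriv u) x = (1 + (deriv u x)\<^sup>2) * (deriv \<phi> (u x) - deriv u x / x))"
    if "x \<in> J" for x
  proof -
    from loc[OF that] obtain K v S where v: "graph_solution \<phi> a z0 K v" and S: "x \<in> S" "open S" "S \<subseteq> K"
      and eq: "\<And>y. y \<in> S \<Longrightarrow> v y = u y"
      by metis
    note D = graph_solutionD[OF v]
    have d1: "(u has_real_derivative deriv v y) (at y)" if "y \<in> S" for y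
      using D(7) S(2) that eq by (rule has_field_derivative_transform_within_open) (use that S in auto)
    then have e1: "deriv v y = deriv u y" if "y \<in> S" for y
      using that by (metis DERIV_imp_deriv)
    have d2: "(deriv u has_real_derivative deriv (deriv v) y) (at y)" if "y \<in> S" for y
      using D(8) S(2) that e1 by (rule has_field_derivative_transform_within_open) (use that S in auto)
    then have e2: "deriv (deriv v) y = deriv (deriv u) y" if "y \<in> S" for y
      using that by (metis DERIV_imp_deriv)
    have "continuous_on S (deriv (deriv u))"
      using continuous_on_subset[OF D(9) S(3)] by (simp add: e2 cong: continuous_on_cong)
    then have "isCont (deriv (deriv u)) x"
      using S by (simp add: continuous_on_eq_continuous_at)
    moreover have "x \<in> K" using S by blast
    ultimately show ?thesis
      using d1[OF S(1)] d2[OF S(1)] D(4,5) D(6)[of x] D(10)[of x] eq[OF S(1)] e1[OF S(1)] e2[OF S(1)]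
      by (cases "x = 0") simp_all
  qed
  moreover have "0 \<in> J" using J by (simp add: open_interval_at_0_def)
  ultimately show ?thesis
    by (intro graph_solutionI[OF J, where p = "deriv u" and q = "deriv (deriv u)"]
        continuous_at_imp_continuous_on) blast+
qed

lemma graph_solution_Un:
  assumes u: "graph_solution \<phi> a z0 J u" and v: "graph_solution \<phi> a z0 K v"
    and eq: "\<And>x. x \<in> J \<Longrightarrow> x \<in> K \<Longrightarrow> u x = v x"
  shows "graph_solution \<phi> a z0 (J \<union> K) (\<lambda>x. if x \<in> J then u x else v x)"
proof (rule graph_solution_local)
  show "open_interval_at_0 (J \<union> K)"
    using u v by (intro open_interval_at_0_Un) (auto simp: graph_solution_def)
  fix x assume "x \<in> J \<union> K"
  then show "\<exists>L w S. graph_solution \<phi> a z0 L w \<and> x \<in> S \<and> open S \<and> S \<subseteq> L \<and>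
      (\<forall>y\<in>S. (if y \<in> J then u y else v y) = w y)"
  proof
    assume "x \<in> J"
    then show ?thesis
      using u graph_solutionD(1)[OF u] by (intro exI[of _ J] exI[of _ u]) auto
  next
    assume "x \<in> K"
    then show ?thesis
      using v graph_solutionD(1)[OF v] eq by (intro exI[of _ K] exI[of _ v]) auto
  qed
qed

section \<open>Monotonicity, uniqueness and evenness\<close>

context weight
begin

lemma graph_solution_deriv_mono:
  assumes u: "graph_solution \<phi> a z0 J u" and "x \<in> J" "y \<in> J" "x \<le> y"
  shows "deriv u x \<le> deriv u y"
proof (rule DERIV_nonneg_imp_nondecreasing[OF assms(4)])
  fix t assume "x \<le> t" "t \<le> y"
  then have "t \<in> J"
    using mem_is_interval_1_I[OF graph_solutionD(2)[OF u]] assms(2,3) by blast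
  then show "\<exists>d. (deriv u has_real_derivative d) (at t) \<and> 0 \<le> d"
    using graph_solutionD(8)[OF u] graph_solution_deriv2_pos[OF u] less_imp_le by blast
qed

lemma graph_solution_mono:
  assumes u: "graph_solution \<phi> a z0 J u" and "0 \<le> x" "y \<in> J" "x \<le> y"
  shows "u x \<le> u y"
proof (rule DERIV_nonneg_imp_nondecreasing[OF assms(4)])
  note D = graph_solutionD[OF u]
  fix t assume "x \<le> t" "t \<le> y"
  then have "t \<in> J" "0 \<le> t"
    using mem_is_interval_1_I[OF D(2,3) assms(3)] assms(2) by auto
  then show "\<exists>d. (u has_real_derivative d) (at t) \<and> 0 \<le> d"
    using D(7) graph_solution_deriv_mono[OF u D(3)] D(5) by metis
qed

text \<open>Gronwall's argument for the energy \<open>E\<close>, the squared distance of (u, u') and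
  (v, v'): it vanishes at 0 and satisfies E' \<le> M E, because the singular term only helps on the
  right of 0.\<close>

lemma graph_solution_unique:
  assumes u: "graph_solution \<phi> a z0 J u" and v: "graph_solution \<phi> a z0 K v"
    and b: "b \<in> J" "b \<in> K" "b > 0"
  shows "u b = v b"
proof -
  note Du = graph_solutionD[OF u] and Dv = graph_solutionD[OF v]
  have sub: "x \<in> J" "x \<in> K" if "0 \<le> x" "x \<le> b" for x
    using mem_is_interval_1_I[OF Du(2,3) b(1)] mem_is_interval_1_I[OF Dv(2,3) b(2)] that by auto
  \<comment> \<open>Slopes are nondecreasing, so their values at \<open>b\<close> bound them on the
    whole interval. In the same way \<open>F\<close> bounds \<phi>'(v), and hence \<phi>'(v) - v'/x,
    which lies between 0 and \<phi>'(v).\<close>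
  define A where "A = max (deriv u b) (deriv v b)"
  define F where "F = deriv \<phi> (v b)"
  have z0: "z0 \<in> einterval a \<infinity>" using Du(3,4,6) by blast
  obtain C where C: "C \<ge> 0" "\<And>s t. s \<in> {z0..max (u b) (v b)} \<Longrightarrow> t \<in> {z0..max (u b) (v b)} \<Longrightarrow>
      \<bar>deriv \<phi> s - deriv \<phi> t\<bar> \<le> C * \<bar>s - t\<bar>"
    using deriv_lipschitz[OF z0] by blast
  \<comment> \<open>The summands absorb, in order, the product 2 d w of the differences d and w of
    values and slopes, the Lipschitz term in \<phi>', and the term from u'^2 - v'^2.\<close>
  define M where "M = 1 + (1 + A\<^sup>2) * C + 4 * A * F"
  define E where "E x = (u x - v x)\<^sup>2 + (deriv u x - deriv v x)\<^sup>2" for x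
  define E' where "E' x = 2 * (u x - v x) * (deriv u x - deriv v x) +
      2 * (deriv u x - deriv v x) * (deriv (deriv u) x - deriv (deriv v) x)" for x
  have E_deriv: "(E has_real_derivative E' x) (at x)" if "0 \<le> x" "x \<le> b" for x
    unfolding E_def E'_def using Du(7,8) Dv(7,8) sub[OF that]
    by (auto intro!: derivative_eq_intros simp: algebra_simps)
  have gronwall: "E' x \<le> M * E x" if x: "0 < x" "x \<le> b" for x
  proof -
    define d where "d = u x - v x"
    define w where "w = deriv u x - deriv v x"
    have xJK: "x \<in> J" "x \<in> K" using sub x by auto
    have slopes: "0 < deriv u x" "deriv u x \<le> A" "0 < deriv v x" "deriv v x \<le> A"
      using graph_solution_slope_bounds(1)[OF u xJK(1) x(1)] graph_solution_slope_bounds(1)[OF v xJK(2) x(1)]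
        graph_solution_deriv_mono[OF u xJK(1) b(1) x(2)] graph_solution_deriv_mono[OF v xJK(2) b(2) x(2)]
      by (auto simp: A_def)
    have vF: "0 \<le> deriv \<phi> (v x) - deriv v x / x" "deriv \<phi> (v x) - deriv v x / x \<le> F"
    proof -
      show "0 \<le> deriv \<phi> (v x) - deriv v x / x"
        using graph_solution_slope_bounds(2)[OF v xJK(2) x(1)] x(1) by (simp add: field_simps)
      have "deriv \<phi> (v x) \<le> F"
        unfolding F_def using Dv(6)[OF xJK(2)] graph_solution_mono[OF v _ b(2) x(2)] x(1)
        by (intro deriv_mono) auto
      moreover have "0 \<le> deriv v x / x" using slopes x by simp
      ultimately show "deriv \<phi> (v x) - deriv v x / x \<le> F" by linarith
    qed
    have "u x \<in> {z0..max (u b) (v b)}" "v x \<in> {z0..max (u b) (v b)}"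
      using graph_solution_mono[OF u _ b(1) x(2)] graph_solution_mono[OF v _ b(2) x(2)]
        graph_solution_mono[OF u _ xJK(1), of 0] graph_solution_mono[OF v _ xJK(2), of 0] x Du(4) Dv(4)
      by auto
    then have lip: "\<bar>deriv \<phi> (u x) - deriv \<phi> (v x)\<bar> \<le> C * \<bar>d\<bar>"
      using C(2) by (simp add: d_def)
    have A: "(deriv u x)\<^sup>2 \<le> A\<^sup>2" using slopes by (intro power_mono) auto
    \<comment> \<open>Splitting the difference of the right-hand sides isolates the singular part
      -(1 + u'^2) w / x from a Lipschitz part and a part with the factor u'^2 - v'^2 = w(u' +
      v').\<close>
    have eq: "deriv (deriv u) x - deriv (deriv v) x =
        (1 + (deriv u x)\<^sup>2) * (deriv \<phi> (u x) - deriv \<phi> (v x)) - (1 + (deriv u x)\<^sup>2) * w / x +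
        w * (deriv u x + deriv v x) * (deriv \<phi> (v x) - deriv v x / x)"
      unfolding w_def Du(10)[OF xJK(1) x(1)[THEN less_imp_neq, symmetric]]
        Dv(10)[OF xJK(2) x(1)[THEN less_imp_neq, symmetric]]
      by (simp add: algebra_simps diff_divide_distrib add_divide_distrib power2_eq_square)
    have "w * ((1 + (deriv u x)\<^sup>2) * (deriv \<phi> (u x) - deriv \<phi> (v x)))
        \<le> \<bar>w\<bar> * ((1 + A\<^sup>2) * (C * \<bar>d\<bar>))"
    proof -
      have "(1 + (deriv u x)\<^sup>2) * \<bar>deriv \<phi> (u x) - deriv \<phi> (v x)\<bar> \<le> (1 + A\<^sup>2) * (C * \<bar>d\<bar>)"
        using A lip by (intro mult_mono) auto
      then have "\<bar>w * ((1 + (deriv u x)\<^sup>2) * (deriv \<phi> (u x) - deriv \<phi> (v x)))\<bar>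
          \<le> \<bar>w\<bar> * ((1 + A\<^sup>2) * (C * \<bar>d\<bar>))"
        by (simp add: abs_mult mult_left_mono)
      then show ?thesis by linarith
    qed
    \<comment> \<open>After multiplication by w the singular part has a sign for x > 0, so no bound
      on 1/x is required and \<open>M\<close> stays uniform down to 0.\<close>
    moreover have "w * ((1 + (deriv u x)\<^sup>2) * w / x) \<ge> 0"
    proof -
      have "w * ((1 + (deriv u x)\<^sup>2) * w / x) = (1 + (deriv u x)\<^sup>2) * w\<^sup>2 / x"
        by (simp add: power2_eq_square)
      also have "\<dots> \<ge> 0" using x by (intro divide_nonneg_pos mult_nonneg_nonneg) auto
      finally show ?thesis .
    qed
    moreover have "w * (w * (deriv u x + deriv v x) * (deriv \<phi> (v x) - deriv v x / x)) \<le> w\<^sup>2 * (2 * A * F)"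
    proof -
      have "(deriv u x + deriv v x) * (deriv \<phi> (v x) - deriv v x / x) \<le> 2 * A * F"
        using slopes vF by (intro mult_mono) auto
      then show ?thesis
        using mult_left_mono[of _ _ "w\<^sup>2"] by (simp add: power2_eq_square mult.assoc)
    qed
    ultimately have "w * (deriv (deriv u) x - deriv (deriv v) x)
        \<le> \<bar>w\<bar> * ((1 + A\<^sup>2) * (C * \<bar>d\<bar>)) + w\<^sup>2 * (2 * A * F)"
      unfolding eq by (simp add: algebra_simps)
    moreover have "E' x = 2 * (d * w) + 2 * (w * (deriv (deriv u) x - deriv (deriv v) x))"
      by (simp add: E'_def d_def w_def algebra_simps)
    moreover have "2 * (d * w) \<le> d\<^sup>2 + w\<^sup>2"
      using sum_squares_bound[of d w] by simp
    moreover have "2 * (\<bar>w\<bar> * ((1 + A\<^sup>2) * (C * \<bar>d\<bar>))) \<le> ((1 + A\<^sup>2) * C) * (d\<^sup>2 + w\<^sup>2)"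
    proof -
      have "((1 + A\<^sup>2) * C) * (2 * \<bar>d\<bar> * \<bar>w\<bar>) \<le> ((1 + A\<^sup>2) * C) * (\<bar>d\<bar>\<^sup>2 + \<bar>w\<bar>\<^sup>2)"
        using C(1) sum_squares_bound[of "\<bar>d\<bar>" "\<bar>w\<bar>"] by (intro mult_left_mono) auto
      then show ?thesis by (simp add: mult_ac)
    qed
    \<comment> \<open>Supplies the d^2 share of 4 A F E, which the estimates above do not
      produce.\<close>
    moreover have "0 \<le> (4 * A * F) * d\<^sup>2"
      using slopes vF by (intro mult_nonneg_nonneg) auto
    ultimately show ?thesis
      unfolding M_def E_def d_def[symmetric] w_def[symmetric] by (simp add: algebra_simps)
  qed
  have "E b * exp (- (M * b)) \<le> E 0 * exp (- (M * 0))"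
  proof (rule DERIV_nonpos_imp_nonincreasing[where f = "\<lambda>x. E x * exp (- (M * x))"])
    fix x assume x: "0 \<le> x" "x \<le> b"
    have "((\<lambda>x. E x * exp (- (M * x))) has_real_derivative (E' x - M * E x) * exp (- (M * x))) (at x)"
      using E_deriv[OF x] by (auto intro!: derivative_eq_intros simp: algebra_simps)
    \<comment> \<open>The Gronwall inequality was shown for x > 0; at 0 both \<open>E\<close> and
      \<open>E'\<close> vanish by the common initial data.\<close>
    moreover have "E' x - M * E x \<le> 0"
      using gronwall[of x] x Du(4,5) Dv(4,5) by (cases "x = 0") (auto simp: E'_def E_def)
    ultimately show "\<exists>y. ((\<lambda>x. E x * exp (- (M * x))) has_real_derivative y) (at x) \<and> y \<le> 0"
      using mult_nonpos_nonneg exp_ge_zero by blast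
  qed (use b in simp)
  then have "E b * exp (- (M * b)) \<le> 0"
    using Du(4,5) Dv(4,5) by (simp add: E_def)
  then have "E b \<le> 0"
    by (simp add: mult_le_0_iff)
  then show ?thesis
    by (simp add: E_def sum_power2_le_zero_iff)
qed

text \<open>By uniqueness a solution and its reflection agree where both are defined. Together they
  form a solution on the union of the two domains, which maximality forces back to
  \<open>J\<close>.\<close>

lemma maximal_graph_solution_even:
  assumes "maximal_graph_solution \<phi> a z0 J u"
  shows "uminus ` J = J" and "x \<in> J \<Longrightarrow> u (- x) = u x"
proof -
  have u: "graph_solution \<phi> a z0 J u"
    using assms by (simp add: maximal_graph_solution_def)
  note R = graph_solution_reflect[OF u]
  have mirror: "x \<in> uminus ` J \<longleftrightarrow> - x \<in> J" for x
    by (metis (no_types, lifting) add.inverse_inverse image_iff)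
  have even_pos: "u x = u (- x)" if "x \<in> J" "- x \<in> J" "x > 0" for x
    using graph_solution_unique[OF u R that(1) _ that(3)] that(2) by (simp add: mirror)
  have even: "u x = u (- x)" if "x \<in> J" "- x \<in> J" for x
  proof -
    consider "x > 0" | "x = 0" | "- x > 0" by linarith
    then show ?thesis
    proof cases
      case 3
      with even_pos[of "- x"] that show ?thesis by simp
    qed (use even_pos that in simp_all)
  qed
  have "graph_solution \<phi> a z0 (J \<union> uminus ` J) (\<lambda>x. if x \<in> J then u x else u (- x))"
    using u R by (rule graph_solution_Un) (use even mirror in blast)
  then have "J \<union> uminus ` J = J"
    using assms unfolding maximal_graph_solution_def by (elim conjE allE impE) (assumption | simp)+
  then have sub: "x \<in> J \<Longrightarrow> - x \<in> J" for x by blast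
  then show "uminus ` J = J"
    using mirror by fastforce
  show "x \<in> J \<Longrightarrow> u (- x) = u x"
    using even[of x] sub[of x] by simp
qed

end

section \<open>From curves to graphs and back\<close>

text \<open>Transfers the regularity of the space curve to its coordinates through the
  projections.\<close>

lemma C2_on_bounded_linear:
  assumes "C2_on f S" and h: "bounded_linear h"
  obtains p q where "\<And>x. x \<in> S \<Longrightarrow> ((\<lambda>t. h (f t)) has_vector_derivative p x) (at x)"
    "\<And>x. x \<in> S \<Longrightarrow> (p has_vector_derivative q x) (at x)" "continuous_on S q"
proof
  note D = C2_onD[OF assms(1)]
  show "((\<lambda>t. h (f t)) has_vector_derivative h (vector_derivative f (at x))) (at x)" if "x \<in> S" for x
    using D(1)[OF that] by (rule bounded_linear.has_vector_derivative[OF h])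
  show "((\<lambda>t. h (vector_derivative f (at t))) has_vector_derivative
      h (vector_derivative (\<lambda>t. vector_derivative f (at t)) (at x))) (at x)" if "x \<in> S" for x
    using D(2)[OF that] by (rule bounded_linear.has_vector_derivative[OF h])
  show "continuous_on S (\<lambda>x. h (vector_derivative (\<lambda>t. vector_derivative f (at t)) (at x)))"
    using D(3) by (rule bounded_linear.continuous_on[OF h])
qed

text \<open>The derivative lifts \<open>f\<close> above 0 just after the origin, and a later sign
  change would need a zero. Applied to the abscissa, this fixes its sign on each side of s =
  0.\<close>

lemma positive_if_nonzero:
  fixes f :: "real \<Rightarrow> real"
  assumes cont: "continuous_on {0..b} f" and "f 0 = 0"
    and deriv: "(f has_real_derivative D) (at 0)" "D > 0"
    and nonzero: "\<And>t. 0 < t \<Longrightarrow> t \<le> b \<Longrightarrow> f t \<noteq> 0" and "b > 0"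
  shows "f b > 0"
proof (rule ccontr)
  assume "\<not> f b > 0"
  obtain d where d: "d > 0" "\<And>h. 0 < h \<Longrightarrow> h < d \<Longrightarrow> f 0 < f (0 + h)"
    using DERIV_pos_inc_right[OF deriv] by blast
  define h where "h = min (d / 2) b"
  have h: "0 < h" "h < d" "h \<le> b"
    using d(1) assms(6) by (auto simp: h_def)
  have "continuous_on {h..b} f"
    by (rule continuous_on_subset[OF cont]) (use h in auto)
  then obtain t where "h \<le> t" "t \<le> b" "f t = 0"
    using IVT2'[of f b 0 h] h d(2)[of h] assms(2) \<open>\<not> f b > 0\<close> by auto
  with nonzero[of t] h show False by auto
qed

text \<open>At a zero of cos \<theta> one has sin^2 \<theta> = 1, so (cos \<theta>)' = 1/x > 0 and
  the first-zero argument applies. The coefficient \<open>h\<close> is left free so that the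
  reflected curve is covered too.\<close>

lemma cos_angle_pos:
  fixes \<theta> h x :: "real \<Rightarrow> real"
  assumes "continuous_on {0..b} \<theta>" and "\<theta> 0 = 0" and "b \<ge> 0"
    and deriv: "\<And>s. 0 < s \<Longrightarrow> s \<le> b \<Longrightarrow>
      (\<theta> has_real_derivative h s * cos (\<theta> s) - sin (\<theta> s) / x s) (at s)"
    and pos: "\<And>s. 0 < s \<Longrightarrow> s \<le> b \<Longrightarrow> x s > 0"
  shows "cos (\<theta> b) > 0"
proof (rule positive_if_increasing_at_zeros[where f = "\<lambda>s. cos (\<theta> s)" and b = b])
  show "continuous_on {0..b} (\<lambda>s. cos (\<theta> s))"
    using assms(1) by (rule continuous_on_cos)
  fix s assume s: "0 < s" "s \<le> b"
  show "((\<lambda>s. cos (\<theta> s)) has_real_derivative - sin (\<theta> s) * (h s * cos (\<theta> s) - sin (\<theta> s) / x s)) (at s)"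
    using deriv[OF s] by (auto intro!: derivative_eq_intros)
  assume cos: "cos (\<theta> s) = 0"
  then have "(sin (\<theta> s))\<^sup>2 = 1"
    using sin_cos_squared_add[of "\<theta> s"] by simp
  then have "- sin (\<theta> s) * (h s * cos (\<theta> s) - sin (\<theta> s) / x s) = 1 / x s"
    by (simp add: cos power2_eq_square)
  then show "- sin (\<theta> s) * (h s * cos (\<theta> s) - sin (\<theta> s) / x s) > 0"
    using pos[OF s] by simp
qed (use assms in auto)

text \<open>By continuity the angle would have to pass through \<plusminus>\<pi>/2, where the cosine
  vanishes. The bound is what permits recovering \<theta> from its tangent.\<close>

lemma abs_angle_less:
  fixes \<theta> :: "real \<Rightarrow> real"
  assumes "is_interval I" and cont: "continuous_on I \<theta>" and "0 \<in> I" "\<theta> 0 = 0"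
    and cos: "\<And>s. s \<in> I \<Longrightarrow> cos (\<theta> s) > 0" and "s \<in> I"
  shows "\<bar>\<theta> s\<bar> < pi / 2"
proof (rule ccontr)
  assume "\<not> \<bar>\<theta> s\<bar> < pi / 2"
  have "is_interval ((\<lambda>s. \<bar>\<theta> s\<bar>) ` I)"
    using assms(1) connected_continuous_image[OF continuous_on_rabs[OF cont]]
    by (simp add: is_interval_connected_1)
  moreover have "0 \<in> (\<lambda>s. \<bar>\<theta> s\<bar>) ` I" "\<bar>\<theta> s\<bar> \<in> (\<lambda>s. \<bar>\<theta> s\<bar>) ` I"
    using assms(3,4,6) by force+
  ultimately have "pi / 2 \<in> (\<lambda>s. \<bar>\<theta> s\<bar>) ` I"
    by (rule mem_is_interval_1_I) (use \<open>\<not> \<bar>\<theta> s\<bar> < pi / 2\<close> in auto)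
  then obtain t where t: "t \<in> I" "\<bar>\<theta> t\<bar> = pi / 2" by force
  then have "cos (\<theta> t) = 0"
    by (metis cos_abs_real cos_pi_half)
  with cos[OF t(1)] show False by simp
qed

text \<open>The system is imposed only for s \<noteq> 0; continuity of \<theta> extends the first
  two equations to s = 0 by a limit of derivatives.\<close>

lemma generating_curve_deriv:
  assumes "generating_curve \<phi> a z0 I x z \<theta>" and "s \<in> I"
  shows "(x has_real_derivative cos (\<theta> s)) (at s)" and "(z has_real_derivative sin (\<theta> s)) (at s)"
proof -
  have I: "open I" "0 \<in> I" "continuous_on I \<theta>"
    and off: "\<And>s. s \<in> I \<Longrightarrow> s \<noteq> 0 \<Longrightarrow> (x has_real_derivative cos (\<theta> s)) (at s)"
      "\<And>s. s \<in> I \<Longrightarrow> s \<noteq> 0 \<Longrightarrow> (z has_real_derivative sin (\<theta> s)) (at s)"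
    and C2: "C2_on (planar_curve x z) I"
    using assms(1) by (auto simp: generating_curve_def open_interval_at_0_def)
  have "continuous_on I (planar_curve x z)"
    by (meson C2_onD(1)[OF C2] has_vector_derivative_continuous continuous_at_imp_continuous_on)
  then have cont: "continuous_on I x" "continuous_on I z"
    unfolding planar_curve_def
    using continuous_on_fst[of I "\<lambda>s. (x s, 0::real, z s)"]
      continuous_on_snd[OF continuous_on_snd[of I "\<lambda>s. (x s, 0::real, z s)"]] by simp_all
  have "isCont \<theta> 0"
    using I by (simp add: continuous_on_eq_continuous_at)
  then have "(x has_real_derivative cos (\<theta> 0)) (at 0)" "(z has_real_derivative sin (\<theta> 0)) (at 0)"
    using off cont by (auto intro!: has_real_derivative_if_tendsto[OF I(1,2)] tendsto_intros simp: isCont_def)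
  with off assms(2) show "(x has_real_derivative cos (\<theta> s)) (at s)"
    "(z has_real_derivative sin (\<theta> s)) (at s)"
    by (cases "s = 0"; simp)+
qed

lemma generating_curve_cos_pos:
  assumes curve: "generating_curve \<phi> a z0 I x z \<theta>" and "s \<in> I"
  shows "cos (\<theta> s) > 0"
proof -
  have I: "is_interval I" "0 \<in> I" "continuous_on I \<theta>" "x 0 = 0" "\<theta> 0 = 0"
    and nonzero: "\<And>s. s \<in> I \<Longrightarrow> s \<noteq> 0 \<Longrightarrow> x s \<noteq> 0"
    and \<theta>: "\<And>s. s \<in> I \<Longrightarrow> s \<noteq> 0 \<Longrightarrow>
        (\<theta> has_real_derivative deriv \<phi> (z s) * cos (\<theta> s) - sin (\<theta> s) / x s) (at s)"
    using curve by (auto simp: generating_curve_def open_interval_at_0_def)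
  note x' = generating_curve_deriv(1)[OF curve]
  have x_cont: "continuous_on I x"
    by (meson x' DERIV_isCont continuous_at_imp_continuous_on)
  consider "s \<ge> 0" | "s < 0" by linarith
  then show ?thesis
  proof cases
    case 1
    have sub: "t \<in> I" if "0 \<le> t" "t \<le> s" for t
      using mem_is_interval_1_I[OF I(1,2) assms(2)] that by blast
    have "x t > 0" if t: "0 < t" "t \<le> s" for t
    proof (rule positive_if_nonzero[where f = x])
      show "(x has_real_derivative 1) (at 0)" using x'[OF I(2)] I(5) by simp
      show "continuous_on {0..t} x"
        by (rule continuous_on_subset[OF x_cont]) (use sub t in auto)
    qed (use sub t nonzero I(4) in auto)
    moreover have "continuous_on {0..s} \<theta>"
      by (rule continuous_on_subset[OF I(3)]) (use sub in auto)
    ultimately show ?thesis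
      using 1 \<theta> sub I(5) by (intro cos_angle_pos[where h = "\<lambda>s. deriv \<phi> (z s)" and x = x]) auto
  next
    case 2
    have sub: "t \<in> I" if "s \<le> t" "t \<le> 0" for t
      using mem_is_interval_1_I[OF I(1) assms(2) I(2)] that by blast
    \<comment> \<open>The reversed data -x(-t) and -\<theta>(-t) satisfy an angle equation of the
      same form on positive times, so the case of negative s reduces to the previous one.\<close>
    have "- x (- t) > 0" if t: "0 < t" "t \<le> - s" for t
    proof (rule positive_if_nonzero[where f = "\<lambda>t. - x (- t)"])
      show "((\<lambda>t. - x (- t)) has_real_derivative 1) (at 0)"
        using x'[OF I(2)] I(5) by (intro DERIV_minus_mirror) simp
      show "continuous_on {0..t} (\<lambda>t. - x (- t))"
        by (intro continuous_on_minus continuous_on_compose2[OF x_cont]) (use sub t in auto)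
    qed (use sub t nonzero I(4) in auto)
    moreover have "continuous_on {0..- s} (\<lambda>t. - \<theta> (- t))"
      by (intro continuous_on_minus continuous_on_compose2[OF I(3)]) (use sub in auto)
    moreover have "((\<lambda>t. - \<theta> (- t)) has_real_derivative
        deriv \<phi> (z (- t)) * cos (- \<theta> (- t)) - sin (- \<theta> (- t)) / - x (- t)) (at t)"
      if "0 < t" "t \<le> - s" for t
      using \<theta>[of "- t"] sub[of "- t"] that by (intro DERIV_minus_mirror) simp
    ultimately have "cos (- \<theta> (- (- s))) > 0"
      using 2 I(5) by (intro cos_angle_pos[where \<theta> = "\<lambda>t. - \<theta> (- t)" and
          h = "\<lambda>t. deriv \<phi> (z (- t))" and x = "\<lambda>t. - x (- t)"]) auto
    then show ?thesis by simp
  qed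
qed

text \<open>Since x' = cos \<theta> > 0, the abscissa is invertible and u = z \<circ> x^{-1} has
  slope tan \<theta>. The angle equation then becomes the graph equation.\<close>

lemma generating_curve_graph:
  assumes curve: "generating_curve \<phi> a z0 I x z \<theta>"
  obtains u where "graph_solution \<phi> a z0 (x ` I) u" "\<And>s. s \<in> I \<Longrightarrow> u (x s) = z s"
    "\<And>s. s \<in> I \<Longrightarrow> deriv u (x s) = tan (\<theta> s)"
proof -
  have I: "open I" "is_interval I" "0 \<in> I" "x 0 = 0" "z 0 = z0" "\<theta> 0 = 0" "z ` I \<subseteq> einterval a \<infinity>"
    and C2: "C2_on (planar_curve x z) I"
    and \<theta>: "\<And>s. s \<in> I \<Longrightarrow> s \<noteq> 0 \<Longrightarrow> x s \<noteq> 0 \<and>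
        (\<theta> has_real_derivative deriv \<phi> (z s) * cos (\<theta> s) - sin (\<theta> s) / x s) (at s)"
    using curve by (auto simp: generating_curve_def open_interval_at_0_def)
  note xz = generating_curve_deriv[OF curve] and cos = generating_curve_cos_pos[OF curve]
  obtain g where g: "open (x ` I)" "is_interval (x ` I)" "\<And>s. s \<in> I \<Longrightarrow> g (x s) = s"
    "\<And>s. s \<in> I \<Longrightarrow> (g has_real_derivative inverse (cos (\<theta> s))) (at (x s))"
    using inverse_on_open_interval[of I x "\<lambda>s. cos (\<theta> s)", OF I(1,2) xz(1) cos] by blast
  obtain px qx where px: "\<And>s. s \<in> I \<Longrightarrow> (x has_real_derivative px s) (at s)"
      "\<And>s. s \<in> I \<Longrightarrow> (px has_real_derivative qx s) (at s)" "continuous_on I qx"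
    using C2_on_bounded_linear[OF C2 bounded_linear_fst]
    by (auto simp: planar_curve_def has_real_derivative_iff_has_vector_derivative)
  obtain pz qz where pz: "\<And>s. s \<in> I \<Longrightarrow> (z has_real_derivative pz s) (at s)"
      "\<And>s. s \<in> I \<Longrightarrow> (pz has_real_derivative qz s) (at s)" "continuous_on I qz"
    using C2_on_bounded_linear[OF C2 bounded_linear_compose[OF bounded_linear_snd bounded_linear_snd]]
    by (auto simp: planar_curve_def has_real_derivative_iff_has_vector_derivative)
  have px_eq: "px s = cos (\<theta> s)" and pz_eq: "pz s = sin (\<theta> s)" if "s \<in> I" for s
    using DERIV_unique px(1) pz(1) xz that by blast+
  \<comment> \<open>The derivative of tan \<theta> is obtained as that of the quotient z'/x' from
    the C2 regularity of the curve. This covers s = 0, where the equation for \<theta> says nothing,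
    and makes \<open>r\<close> continuous.\<close>
  define r where "r s = (qz s * px s - pz s * qx s) / (px s)\<^sup>2" for s
  have tan': "((\<lambda>s. tan (\<theta> s)) has_real_derivative r s) (at s)" if "s \<in> I" for s
  proof (rule has_field_derivative_transform_within_open[OF _ I(1) that])
    show "((\<lambda>s. pz s / px s) has_real_derivative r s) (at s)"
      using px(2)[OF that] pz(2)[OF that] cos[OF that] px_eq[OF that]
      by (auto intro!: derivative_eq_intros simp: r_def power2_eq_square)
  qed (simp add: px_eq pz_eq tan_def)
  have r_cont: "continuous_on I r"
  proof -
    have "continuous_on I px" "continuous_on I pz"
      by (meson px(2) pz(2) DERIV_isCont continuous_at_imp_continuous_on)+
    then show ?thesis
      unfolding r_def using px(3) pz(3) cos px_eq by (intro continuous_intros) force+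
  qed
  define u where "u y = z (g y)" for y
  define p where "p y = tan (\<theta> (g y))" for y
  define q where "q y = r (g y) * inverse (px (g y))" for y
  have u': "(u has_real_derivative p y) (at y)" and p': "(p has_real_derivative q y) (at y)"
    if y: "y \<in> x ` I" for y
  proof -
    obtain s where s: "s \<in> I" "y = x s" using y by blast
    have gy: "g y = s" using g(3) s by simp
    have "(u has_real_derivative sin (\<theta> s) * inverse (cos (\<theta> s))) (at y)"
      unfolding u_def s(2)
      by (rule DERIV_chain2[OF _ g(4)[OF s(1)]]) (use xz(2) s(1) g(3) in simp)
    then show "(u has_real_derivative p y) (at y)"
      by (simp add: p_def gy tan_def divide_inverse)
    have "(p has_real_derivative r s * inverse (cos (\<theta> s))) (at y)"
      unfolding p_def s(2)
      by (rule DERIV_chain2[OF _ g(4)[OF s(1)]]) (use tan' s(1) g(3) in simp)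
    then show "(p has_real_derivative q y) (at y)"
      by (simp add: q_def gy px_eq[OF s(1)])
  qed
  have "graph_solution \<phi> a z0 (x ` I) u"
  proof (rule graph_solutionI[OF _ u' p'])
    show "open_interval_at_0 (x ` I)"
      using g(1,2) I(3,4) by (force simp: open_interval_at_0_def)
    have g_cont: "continuous_on (x ` I) g"
      using g(4) DERIV_isCont by (blast intro: continuous_at_imp_continuous_on)
    have px_cont: "continuous_on I px"
      by (meson px(2) DERIV_isCont continuous_at_imp_continuous_on)
    have gI: "g ` x ` I \<subseteq> I" using g(3) by auto
    have "px (g y) \<noteq> 0" if "y \<in> x ` I" for y
    proof -
      have "g y \<in> I" using gI that by blast
      then show ?thesis using cos px_eq by fastforce
    qed
    then show "continuous_on (x ` I) q"
      unfolding q_def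
      by (intro continuous_on_mult continuous_on_inverse ballI
          continuous_on_compose2[OF r_cont g_cont gI] continuous_on_compose2[OF px_cont g_cont gI])
    show "u ` x ` I \<subseteq> einterval a \<infinity>" using I(7) g(3) by (auto simp: u_def)
    have "g 0 = 0" using g(3)[OF I(3)] I(4) by simp
    then show "u 0 = z0" "p 0 = 0" using I by (auto simp: u_def p_def)
    fix y assume y: "y \<in> x ` I" "y \<noteq> 0"
    then obtain s where s: "s \<in> I" "y = x s" "s \<noteq> 0" using I(4) by auto
    have gy: "g y = s" using g(3) s by simp
    define c where "c = cos (\<theta> s)"
    have c: "c > 0" using cos s by (simp add: c_def)
    \<comment> \<open>Away from 0 the angle equation gives a second formula for the derivative of
      tan \<theta>; uniqueness of derivatives identifies it with \<open>r\<close>. The factor 1 /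
      cos^2 \<theta> is 1 + u'^2.\<close>
    have "((\<lambda>s. tan (\<theta> s)) has_real_derivative
        (deriv \<phi> (z s) * cos (\<theta> s) - sin (\<theta> s) / x s) * inverse ((cos (\<theta> s))\<^sup>2)) (at s)"
      using \<theta>[OF s(1,3)] c by (auto intro!: derivative_eq_intros simp: c_def)
    then have r: "r s = (deriv \<phi> (z s) * cos (\<theta> s) - sin (\<theta> s) / x s) * inverse ((cos (\<theta> s))\<^sup>2)"
      by (rule DERIV_unique[OF tan'[OF s(1)]])
    have sec: "1 + (tan (\<theta> s))\<^sup>2 = inverse ((cos (\<theta> s))\<^sup>2)"
      using tan_sec[of "\<theta> s"] c by (simp add: c_def power_inverse)
    have "(deriv \<phi> (z s) * cos (\<theta> s) - sin (\<theta> s) / x s) * inverse (cos (\<theta> s))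
        = deriv \<phi> (z s) - tan (\<theta> s) / x s"
      using c by (simp add: c_def tan_def diff_divide_distrib inverse_eq_divide mult.commute)
    moreover have "q y = r s * inverse (cos (\<theta> s))" "p y = tan (\<theta> s)" "u y = z s"
      by (simp_all add: q_def p_def u_def gy px_eq[OF s(1)])
    ultimately show "q y = (1 + (p y)\<^sup>2) * (deriv \<phi> (u y) - p y / y)"
      using s(2) by (simp add: r sec mult_ac)
  qed
  moreover have "u (x s) = z s" "deriv u (x s) = tan (\<theta> s)" if "s \<in> I" for s
    using u'[of "x s", THEN DERIV_imp_deriv] that g(3) by (auto simp: u_def p_def)
  ultimately show thesis using that by blast
qed

text \<open>Converse passage: parametrize the graph by its arc length \<open>S\<close> from 0, let
  \<open>x\<close> be the inverse of \<open>S\<close>, and take the arctangent of the slope as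
  angle.\<close>

lemma graph_solution_curve:
  assumes v: "graph_solution \<phi> a z0 K v"
  obtains S x where "S 0 = 0" "\<And>t. t \<in> K \<Longrightarrow> (S has_real_derivative sqrt (1 + (deriv v t)\<^sup>2)) (at t)"
    "\<And>t. t \<in> K \<Longrightarrow> x (S t) = t"
    "generating_curve \<phi> a z0 (S ` K) x (\<lambda>s. v (x s)) (\<lambda>s. arctan (deriv v (x s)))"
proof -
  note D = graph_solutionD[OF v]
  have "continuous_on K (\<lambda>t. sqrt (1 + (deriv v t)\<^sup>2))"
    by (intro continuous_intros graph_solution_continuous[OF v])
  then obtain F where F: "\<And>t. t \<in> K \<Longrightarrow> (F has_real_derivative sqrt (1 + (deriv v t)\<^sup>2)) (at t)"
    using antiderivative_on_open_interval[OF D(1,2)] D(3) by blast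
  define S where "S t = F t - F 0" for t
  have S: "(S has_real_derivative sqrt (1 + (deriv v t)\<^sup>2)) (at t)" if "t \<in> K" for t
    unfolding S_def using F[OF that] by (auto intro!: derivative_eq_intros)
  have pos: "0 < sqrt (1 + (deriv v t)\<^sup>2)" for t
    by (simp add: add_pos_nonneg)
  obtain x where x: "open (S ` K)" "is_interval (S ` K)" "\<And>t. t \<in> K \<Longrightarrow> x (S t) = t"
    "\<And>t. t \<in> K \<Longrightarrow> (x has_real_derivative inverse (sqrt (1 + (deriv v t)\<^sup>2))) (at (S t))"
    using inverse_on_open_interval[OF D(1,2) S pos] by blast
  define \<theta> where "\<theta> s = arctan (deriv v (x s))" for s
  \<comment> \<open>The chain rule expression for \<theta>' involves u'' and stays continuous at s =
    0; it is rewritten by the graph equation only for s \<noteq> 0.\<close>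
  define \<tau> where "\<tau> s = inverse (1 + (deriv v (x s))\<^sup>2) * (deriv (deriv v) (x s) * cos (\<theta> s))" for s
  have xK: "x s \<in> K" if "s \<in> S ` K" for s using that x(3) by auto
  have x': "(x has_real_derivative cos (\<theta> s)) (at s)" if "s \<in> S ` K" for s
    using that x(3,4) by (auto simp: \<theta>_def cos_arctan inverse_eq_divide)
  have z': "((\<lambda>s. v (x s)) has_real_derivative sin (\<theta> s)) (at s)" if "s \<in> S ` K" for s
    using DERIV_chain2[OF D(7)[OF xK[OF that]] x'[OF that]]
    by (simp add: \<theta>_def cos_arctan sin_arctan)
  have \<theta>': "(\<theta> has_real_derivative \<tau> s) (at s)" if "s \<in> S ` K" for s
    unfolding \<theta>_def[abs_def] \<tau>_def
    using DERIV_chain2[OF DERIV_arctan DERIV_chain2[OF D(8)[OF xK[OF that]] x'[OF that]]]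
    by (simp add: \<theta>_def)
  have cont: "continuous_on (S ` K) x" "continuous_on (S ` K) \<theta>"
    by (meson x' \<theta>' DERIV_isCont continuous_at_imp_continuous_on)+
  have \<tau>_cont: "continuous_on (S ` K) \<tau>"
    unfolding \<tau>_def using xK
    by (intro continuous_intros cont(2) continuous_on_compose2[OF D(9) cont(1)]
        continuous_on_compose2[OF graph_solution_continuous(2)[OF v] cont(1)])
      (auto simp: add_nonneg_eq_0_iff)
  have C2: "C2_on (planar_curve x (\<lambda>s. v (x s))) (S ` K)"
  proof (rule C2_onI[OF x(1)])
    fix s assume s: "s \<in> S ` K"
    show "(planar_curve x (\<lambda>s. v (x s)) has_vector_derivative (cos (\<theta> s), 0, sin (\<theta> s))) (at s)"
      unfolding planar_curve_def using x'[OF s] z'[OF s]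
      by (auto intro!: has_vector_derivative_Pair simp: has_real_derivative_iff_has_vector_derivative)
    have "((\<lambda>s. cos (\<theta> s)) has_real_derivative - sin (\<theta> s) * \<tau> s) (at s)"
      "((\<lambda>s. sin (\<theta> s)) has_real_derivative cos (\<theta> s) * \<tau> s) (at s)"
      using \<theta>'[OF s] by (auto intro!: derivative_eq_intros)
    then show "((\<lambda>s. (cos (\<theta> s), 0, sin (\<theta> s))) has_vector_derivative
        (- sin (\<theta> s) * \<tau> s, 0, cos (\<theta> s) * \<tau> s)) (at s)"
      by (auto intro!: has_vector_derivative_Pair simp: has_real_derivative_iff_has_vector_derivative)
  qed (intro continuous_intros cont \<tau>_cont)
  have S0: "S 0 = 0" by (simp add: S_def)
  then have x0: "x 0 = 0" using x(3)[OF D(3)] by simp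
  have ode: "x s \<noteq> 0 \<and> \<tau> s = deriv \<phi> (v (x s)) * cos (\<theta> s) - sin (\<theta> s) / x s"
    if s: "s \<in> S ` K" "s \<noteq> 0" for s
  proof
    show "x s \<noteq> 0" using s x(3) S0 by force
    have "1 + (deriv v (x s))\<^sup>2 > 0" by (simp add: add_pos_nonneg)
    then have "\<tau> s = (deriv \<phi> (v (x s)) - deriv v (x s) / x s) * cos (\<theta> s)"
      unfolding \<tau>_def D(10)[OF xK[OF s(1)] \<open>x s \<noteq> 0\<close>] by simp
    moreover have "sin (\<theta> s) = deriv v (x s) * cos (\<theta> s)"
      by (simp add: \<theta>_def sin_arctan cos_arctan)
    ultimately show "\<tau> s = deriv \<phi> (v (x s)) * cos (\<theta> s) - sin (\<theta> s) / x s"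
      by (simp add: algebra_simps)
  qed
  have oi: "open_interval_at_0 (S ` K)"
    using x(1,2) S0 D(3) by (force simp: open_interval_at_0_def)
  \<comment> \<open>The whole curve is the graph of \<open>v\<close>, so the clause about the
    behaviour near s = 0 is met with \<open>N\<close> and \<open>J\<close> taken as large as
    possible.\<close>
  have "planar_curve x (\<lambda>s. v (x s)) ` S ` K = graph_over v K"
    using x(3) by (auto simp: planar_curve_def graph_over_def image_iff)
  then have near: "\<exists>N J u. open_interval_at_0 N \<and> N \<subseteq> S ` K \<and> graph_solution \<phi> a z0 J u \<and>
      planar_curve x (\<lambda>s. v (x s)) ` N = graph_over u J"
    using oi v by blast
  have "generating_curve \<phi> a z0 (S ` K) x (\<lambda>s. v (x s)) \<theta>"
    unfolding generating_curve_def
  proof (intro conjI ballI)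
    fix s assume s: "s \<in> S ` K - {0}"
    then show "x s \<noteq> 0" "(\<theta> has_real_derivative
        deriv \<phi> (v (x s)) * cos (\<theta> s) - sin (\<theta> s) / x s) (at s)"
      using ode[of s] \<theta>'[of s] by auto
  qed (use oi C2 cont(2) D(4-6) xK x0 x' z' near in \<open>auto simp: \<theta>_def\<close>)
  with that[of S x] S0 S x(3) show thesis
    by (simp add: \<theta>_def[abs_def])
qed

text \<open>Any extension of the graph function, reparametrized by arc length, would extend the
  given curve; maximality of the curve therefore passes to the graph.\<close>

lemma maximal_generating_curve_graph:
  assumes "maximal_generating_curve \<phi> a z0 I x z \<theta>"
  obtains u where "maximal_graph_solution \<phi> a z0 (x ` I) u"
    "planar_curve x z ` I = graph_over u (x ` I)"
proof -
  have curve: "generating_curve \<phi> a z0 I x z \<theta>"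
    and maximal: "\<And>I' x' z' \<theta>'. generating_curve \<phi> a z0 I' x' z' \<theta>' \<Longrightarrow> I \<subseteq> I' \<Longrightarrow>
      (\<forall>s\<in>I. x' s = x s \<and> z' s = z s \<and> \<theta>' s = \<theta> s) \<Longrightarrow> I' = I"
    using assms unfolding maximal_generating_curve_def by blast+
  have I: "is_interval I" "0 \<in> I" "x 0 = 0" "\<theta> 0 = 0" "continuous_on I \<theta>"
    using curve by (auto simp: generating_curve_def open_interval_at_0_def)
  note cos = generating_curve_cos_pos[OF curve]
  obtain u where u: "graph_solution \<phi> a z0 (x ` I) u" and uz: "\<And>s. s \<in> I \<Longrightarrow> u (x s) = z s"
    and u': "\<And>s. s \<in> I \<Longrightarrow> deriv u (x s) = tan (\<theta> s)"
    using generating_curve_graph[OF curve] by blast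
  have "K = x ` I" if v: "graph_solution \<phi> a z0 K v" and sub: "x ` I \<subseteq> K"
    and eq: "\<forall>t\<in>x ` I. v t = u t" for K v
  proof -
    obtain S y where S0: "S 0 = 0"
      and S: "\<And>t. t \<in> K \<Longrightarrow> (S has_real_derivative sqrt (1 + (deriv v t)\<^sup>2)) (at t)"
      and y: "\<And>t. t \<in> K \<Longrightarrow> y (S t) = t"
      and curve': "generating_curve \<phi> a z0 (S ` K) y (\<lambda>s. v (y s)) (\<lambda>s. arctan (deriv v (y s)))"
      using graph_solution_curve[OF v] by blast
    have v': "deriv v (x s) = tan (\<theta> s)" if "s \<in> I" for s
    proof -
      have "(v has_real_derivative deriv u (x s)) (at (x s))"
        using graph_solutionD(7,1)[OF u] by (rule has_field_derivative_transform_within_open) (use that eq in auto)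
      then show ?thesis using u' that DERIV_imp_deriv by metis
    qed
    have arclength: "S (x s) = s" if s: "s \<in> I" for s
    proof -
      \<comment> \<open>Along the curve the speed of S \<circ> x is sqrt(1 + tan^2 \<theta>) cos
        \<theta> = 1. Hence the new parameter is the old one, up to a constant that vanishes at s =
        0.\<close>
      have "((\<lambda>s. S (x s) - s) has_real_derivative 0) (at s)" if s: "s \<in> I" for s
      proof -
        have "1 + (tan (\<theta> s))\<^sup>2 = (inverse (cos (\<theta> s)))\<^sup>2"
          using tan_sec[of "\<theta> s"] cos[OF s] by simp
        then have "sqrt (1 + (deriv v (x s))\<^sup>2) * cos (\<theta> s) = 1"
          using v'[OF s] cos[OF s] by simp
        moreover have "((\<lambda>s. S (x s)) has_real_derivative sqrt (1 + (deriv v (x s))\<^sup>2) * cos (\<theta> s)) (at s)"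
          using S sub s generating_curve_deriv(1)[OF curve s] by (intro DERIV_chain2) auto
        ultimately show ?thesis by (auto intro!: derivative_eq_intros)
      qed
      then have "\<exists>c. \<forall>s\<in>I. S (x s) - s = c"
        using has_field_derivative_zero_constant[of I "\<lambda>s. S (x s) - s"] I(1)
        by (auto intro: has_field_derivative_at_within simp: is_interval_convex)
      then obtain c where c: "\<And>s. s \<in> I \<Longrightarrow> S (x s) - s = c" by blast
      have "c = 0" using c[OF I(2)] I(3) S0 by simp
      with c[OF s] show ?thesis by simp
    qed
    have "S ` K = I"
    proof (rule maximal[OF curve'])
      show "I \<subseteq> S ` K" using arclength sub by (force simp: image_iff)
      show "\<forall>s\<in>I. y s = x s \<and> v (y s) = z s \<and> arctan (deriv v (y s)) = \<theta> s"
      proof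
        fix s assume s: "s \<in> I"
        have "y s = x s" using y[of "x s"] arclength[OF s] sub s by auto
        moreover have "arctan (tan (\<theta> s)) = \<theta> s"
          using abs_angle_less[OF I(1,5,2,4) cos s] by (intro arctan_tan) auto
        ultimately show "y s = x s \<and> v (y s) = z s \<and> arctan (deriv v (y s)) = \<theta> s"
          using eq uz v' s by simp
      qed
    qed
    have "K \<subseteq> x ` I"
    proof
      fix t assume t: "t \<in> K"
      then have "S t \<in> I" using \<open>S ` K = I\<close> by blast
      moreover have "x (S t) = t"
        using arclength[OF \<open>S t \<in> I\<close>] y[of "x (S t)"] y[OF t] sub \<open>S t \<in> I\<close> by auto
      ultimately show "t \<in> x ` I" by force
    qed
    with sub show ?thesis by blast
  qed
  with u have "maximal_graph_solution \<phi> a z0 (x ` I) u"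
    by (auto simp: maximal_graph_solution_def)
  moreover have "planar_curve x z ` I = graph_over u (x ` I)"
    using uz by (auto simp: planar_curve_def graph_over_def image_image)
  ultimately show thesis using that by blast
qed

section \<open>Blow-up at the ends of the maximal interval\<close>

text \<open>The limit is the supremum. It will be used for both u and u' at a finite end
  point.\<close>

lemma mono_bounded_tendsto_at_left:
  fixes f :: "real \<Rightarrow> real"
  assumes "a < b" and mono: "\<And>x y. a \<le> x \<Longrightarrow> x \<le> y \<Longrightarrow> y < b \<Longrightarrow> f x \<le> f y"
    and bound: "\<And>x. a \<le> x \<Longrightarrow> x < b \<Longrightarrow> f x \<le> B"
  obtains l where "(f \<longlongrightarrow> l) (at_left b)" "f a \<le> l"
proof
  have bdd: "bdd_above (f ` {a..<b})" using bound by (auto intro!: bdd_aboveI)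
  have upper: "f x \<le> Sup (f ` {a..<b})" if "a \<le> x" "x < b" for x
    using bdd that by (auto intro: cSup_upper)
  then show "f a \<le> Sup (f ` {a..<b})" using assms(1) by simp
  show "(f \<longlongrightarrow> Sup (f ` {a..<b})) (at_left b)"
  proof (rule increasing_tendsto)
    show "\<forall>\<^sub>F x in at_left b. f x \<le> Sup (f ` {a..<b})"
      using eventually_at_left_real[OF assms(1)] by eventually_elim (use upper in auto)
    fix y assume "y < Sup (f ` {a..<b})"
    then obtain x where x: "a \<le> x" "x < b" "y < f x"
      using less_cSup_iff[OF _ bdd] assms(1) by auto
    show "\<forall>\<^sub>F x in at_left b. y < f x"
      using eventually_at_left_real[OF x(2)]
      by eventually_elim (use x mono in \<open>force intro: less_le_trans\<close>)
  qed
qed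

section \<open>Continuation past a finite end point and blow-up\<close>

context weight
begin

text \<open>Written as a first order system for (v, v'), the equation is regular at \<beta> > 0 and
  its right-hand side is Lipschitz on a small ball around the initial data, so Picard's theorem
  applies to the right of \<beta>.\<close>

lemma graph_equation_local_existence:
  assumes "\<beta> > 0" and "L \<in> einterval a \<infinity>"
  obtains \<beta>2 v w where "\<beta> < \<beta>2" "v \<beta> = L" "w \<beta> = M" "continuous_on {\<beta>..\<beta>2} v" "continuous_on {\<beta>..\<beta>2} w"
    "\<And>t. t \<in> {\<beta>..\<beta>2} \<Longrightarrow> v t \<in> einterval a \<infinity>"
    "\<And>t. \<beta> < t \<Longrightarrow> t < \<beta>2 \<Longrightarrow> (v has_real_derivative w t) (at t)"
    "\<And>t. \<beta> < t \<Longrightarrow> t < \<beta>2 \<Longrightarrow>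
      (w has_real_derivative (1 + (w t)\<^sup>2) * (deriv \<phi> (v t) - w t / t)) (at t)"
proof -
  obtain r where r: "r > 0" "cball L r \<subseteq> einterval a \<infinity>"
    using assms(2) open_einterval open_contains_cball by blast
  define Q where "Q t b d = (1 + d\<^sup>2) * (deriv \<phi> b - d / t)" for t b d :: real
  define f where "f t y = (snd y, Q t (fst y) (snd y))" for t :: real and y :: "real \<times> real"
  define P where "P = \<bar>M\<bar> + r"
  have box: "fst y \<in> {L - r..L + r}" "\<bar>snd y\<bar> \<le> P" if "y \<in> cball (L, M) r" for y
  proof -
    have "\<bar>fst y - L\<bar> \<le> r" "\<bar>snd y - M\<bar> \<le> r"
      using that dist_fst_le[of y "(L, M)"] dist_snd_le[of y "(L, M)"]
      by (auto simp: dist_real_def dist_commute)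
    then show "fst y \<in> {L - r..L + r}" "\<bar>snd y\<bar> \<le> P" by (auto simp: P_def)
  qed
  have range: "b \<in> einterval a \<infinity>" if "b \<in> {L - r..L + r}" for b
    using that r(2) by (force simp: dist_real_def)
  have lower: "L - r \<in> einterval a \<infinity>" using r(1) by (intro range) auto
  obtain C where C: "C \<ge> 0" "\<And>s t. s \<in> {L - r..L + r} \<Longrightarrow> t \<in> {L - r..L + r} \<Longrightarrow>
      \<bar>deriv \<phi> s - deriv \<phi> t\<bar> \<le> C * \<bar>s - t\<bar>"
    using deriv_lipschitz[OF lower] by blast
  define F where "F = deriv \<phi> (L + r)"
  have F: "\<bar>deriv \<phi> b\<bar> \<le> F" if "b \<in> {L - r..L + r}" for b
    using deriv_pos[OF range[OF that]] deriv_mono[OF range[OF that], of "L + r"] that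
    by (simp add: F_def)
  have P: "P \<ge> 0" using r(1) by (simp add: P_def)
  \<comment> \<open>The 1 comes from the component v', the rest from \<open>Q\<close>: variation of
    \<phi>', variation of d^2 against \<phi>' \<le> F, and the cubic term d + d^3 divided by t \<ge>
    \<beta>.\<close>
  define \<Lambda> where "\<Lambda> = 1 + (1 + P\<^sup>2) * C + 2 * P * F + (1 + 3 * P\<^sup>2) / \<beta>"
  have lip: "norm (f t y - f t y') \<le> \<Lambda> * norm (y - y')"
    if "t \<in> {\<beta>..\<beta> + 1}" "y \<in> cball (L, M) r" "y' \<in> cball (L, M) r" for t y y'
  proof -
    obtain b d where y: "y = (b, d)" by (cases y)
    obtain b' d' where y': "y' = (b', d')" by (cases y')
    note B = box[OF that(2), unfolded y fst_conv snd_conv] box[OF that(3), unfolded y' fst_conv snd_conv]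
    have t: "t > 0" "\<beta> \<le> t" using that(1) assms(1) by auto
    have nb: "\<bar>b - b'\<bar> \<le> norm (y - y')" "\<bar>d - d'\<bar> \<le> norm (y - y')"
      using norm_fst_le[of "b - b'" "d - d'"] norm_snd_le[of "d - d'" "b - b'"] by (simp_all add: y y')
    \<comment> \<open>The difference d - d' is factored out of d^2 - d'^2 and of d + d^3 - d' -
      d'^3, leaving factors bounded on the ball.\<close>
    have eq: "Q t b d - Q t b' d' = (1 + d\<^sup>2) * (deriv \<phi> b - deriv \<phi> b')
        + (d - d') * ((d + d') * deriv \<phi> b') - (d - d') * ((1 + (d\<^sup>2 + d * d' + d'\<^sup>2)) / t)"
      by (simp add: Q_def algebra_simps power2_eq_square diff_divide_distrib add_divide_distrib)
    have sq: "d\<^sup>2 \<le> P\<^sup>2" "d'\<^sup>2 \<le> P\<^sup>2" "\<bar>d * d'\<bar> \<le> P\<^sup>2"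
      using power_mono[OF B(2), of 2] power_mono[OF B(4), of 2] mult_mono[OF B(2,4) P]
      by (simp_all add: abs_mult power2_eq_square)
    have 1: "\<bar>(1 + d\<^sup>2) * (deriv \<phi> b - deriv \<phi> b')\<bar> \<le> (1 + P\<^sup>2) * C * norm (y - y')"
    proof -
      have "\<bar>(1 + d\<^sup>2) * (deriv \<phi> b - deriv \<phi> b')\<bar> \<le> (1 + P\<^sup>2) * (C * norm (y - y'))"
        unfolding abs_mult
        using sq C(2)[OF B(1,3)] mult_left_mono[OF nb(1) C(1)] by (intro mult_mono) auto
      then show ?thesis by (simp add: mult.assoc)
    qed
    have 2: "\<bar>(d - d') * ((d + d') * deriv \<phi> b')\<bar> \<le> 2 * P * F * norm (y - y')"
    proof -
      have "\<bar>(d + d') * deriv \<phi> b'\<bar> \<le> (2 * P) * F"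
        unfolding abs_mult using B F[OF B(3)] P by (intro mult_mono) auto
      then have "\<bar>(d - d') * ((d + d') * deriv \<phi> b')\<bar> \<le> norm (y - y') * (2 * P * F)"
        unfolding abs_mult[of "d - d'"] using nb by (intro mult_mono) auto
      then show ?thesis by (simp add: mult_ac)
    qed
    have 3: "\<bar>(d - d') * ((1 + (d\<^sup>2 + d * d' + d'\<^sup>2)) / t)\<bar> \<le> (1 + 3 * P\<^sup>2) / \<beta> * norm (y - y')"
    proof -
      have "\<bar>1 + (d\<^sup>2 + d * d' + d'\<^sup>2)\<bar> \<le> 1 + 3 * P\<^sup>2"
        using sq zero_le_power2[of d] zero_le_power2[of d'] unfolding abs_le_iff by linarith
      then have "\<bar>(1 + (d\<^sup>2 + d * d' + d'\<^sup>2)) / t\<bar> \<le> (1 + 3 * P\<^sup>2) / \<beta>"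
        using t assms(1) by (simp add: abs_divide frac_le)
      then have "\<bar>(d - d') * ((1 + (d\<^sup>2 + d * d' + d'\<^sup>2)) / t)\<bar> \<le> norm (y - y') * ((1 + 3 * P\<^sup>2) / \<beta>)"
        unfolding abs_mult[of "d - d'"] using nb by (intro mult_mono) auto
      then show ?thesis by (simp add: mult_ac)
    qed
    have "norm (f t y - f t y') \<le> \<bar>d - d'\<bar> + \<bar>Q t b d - Q t b' d'\<bar>"
      using norm_Pair_le[of "d - d'" "Q t b d - Q t b' d'"] by (simp add: f_def y y')
    also have "\<dots> \<le> norm (y - y') + ((1 + P\<^sup>2) * C * norm (y - y') + 2 * P * F * norm (y - y')
        + (1 + 3 * P\<^sup>2) / \<beta> * norm (y - y'))"
      using nb(2) 1 2 3 unfolding eq by linarith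
    also have "\<dots> = \<Lambda> * norm (y - y')" by (simp add: \<Lambda>_def algebra_simps)
    finally show ?thesis .
  qed
  have cont: "continuous_on ({\<beta>..\<beta> + 1} \<times> cball (L, M) r) (\<lambda>(t, y). f t y)"
  proof -
    have "continuous_on ({\<beta>..\<beta> + 1} \<times> cball (L, M) r) (\<lambda>p. deriv \<phi> (fst (snd p)))"
      by (rule continuous_on_compose2[OF deriv_cont]) (use box(1) range in \<open>auto intro!: continuous_intros\<close>)
    then show ?thesis
      unfolding f_def Q_def case_prod_unfold using assms(1) by (intro continuous_intros) auto
  qed
  obtain \<beta>2 y where y: "\<beta> < \<beta>2" "y \<beta> = (L, M)" "y ` {\<beta>..\<beta>2} \<subseteq> cball (L, M) r"
    and y': "\<And>t. t \<in> {\<beta>..\<beta>2} \<Longrightarrow> (y has_vector_derivative f t (y t)) (at t within {\<beta>..\<beta>2})"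
    by (rule picard_local_existence[of \<beta> "\<beta> + 1", OF _ r(1) cont])
      (simp, erule (2) lip, blast)
  have y_cont: "continuous_on {\<beta>..\<beta>2} y"
    using y' by (rule continuous_on_vector_derivative)
  have y'': "(y has_vector_derivative f t (y t)) (at t)" if "\<beta> < t" "t < \<beta>2" for t
    using y'[of t] that by (simp add: at_within_Icc_at)
  show thesis
  proof (rule that[OF y(1), of "\<lambda>t. fst (y t)" "\<lambda>t. snd (y t)"])
    show "continuous_on {\<beta>..\<beta>2} (\<lambda>t. fst (y t))" "continuous_on {\<beta>..\<beta>2} (\<lambda>t. snd (y t))"
      using y_cont by (auto intro: continuous_intros)
    show "fst (y t) \<in> einterval a \<infinity>" if "t \<in> {\<beta>..\<beta>2}" for t
      using y(3) that by (intro range box(1)) blast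
    show "((\<lambda>t. fst (y t)) has_real_derivative snd (y t)) (at t)" if "\<beta> < t" "t < \<beta>2" for t
      using bounded_linear.has_vector_derivative[OF bounded_linear_fst y''[OF that]]
      by (simp add: f_def has_real_derivative_iff_has_vector_derivative)
    show "((\<lambda>t. snd (y t)) has_real_derivative
        (1 + (snd (y t))\<^sup>2) * (deriv \<phi> (fst (y t)) - snd (y t) / t)) (at t)" if "\<beta> < t" "t < \<beta>2" for t
      using bounded_linear.has_vector_derivative[OF bounded_linear_snd y''[OF that]]
      by (simp add: f_def Q_def has_real_derivative_iff_has_vector_derivative)
  qed (use y(2) in simp_all)
qed

text \<open>A bound on u gives a bound on u'. Both are nondecreasing on [0, \<beta>[, hence converge
  at \<beta>, and the equation can be restarted from these limits; the two pieces fit together to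
  second order.\<close>

lemma graph_solution_extend:
  assumes u: "graph_solution \<phi> a z0 J u" and "\<beta> > 0" "\<beta> \<notin> J" and sub: "{0..<\<beta>} \<subseteq> J"
    and bound: "\<And>t. 0 \<le> t \<Longrightarrow> t < \<beta> \<Longrightarrow> u t \<le> B"
  obtains K v where "graph_solution \<phi> a z0 K v" "J \<subset> K" "\<And>t. t \<in> J \<Longrightarrow> v t = u t"
proof -
  note D = graph_solutionD[OF u]
  have J\<beta>: "t < \<beta>" if "t \<in> J" for t
    using mem_is_interval_1_I[OF D(2,3) that, of \<beta>] assms(2,3) by linarith
  have z0: "z0 \<in> einterval a \<infinity>" using D(3,4,6) by blast
  obtain L where L: "(u \<longlongrightarrow> L) (at_left \<beta>)" "u 0 \<le> L"
    by (rule mono_bounded_tendsto_at_left[of 0 \<beta> u B])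
      (use graph_solution_mono[OF u] sub assms(2) bound in \<open>auto simp: subset_iff\<close>)
  have L_dom: "L \<in> einterval a \<infinity>"
    using z0 L(2) D(4) by (auto intro: einterval_upward)
  \<comment> \<open>From u' < t \<phi>'(u), the monotonicity of \<phi>', and t < \<beta>; at t = 0
    the slope is 0.\<close>
  have slope: "deriv u t \<le> \<beta> * deriv \<phi> B" if t: "0 \<le> t" "t < \<beta>" for t
  proof -
    have "t \<in> J" using sub t by auto
    have "deriv \<phi> (u t) \<le> deriv \<phi> B" "0 < deriv \<phi> (u t)"
      using D(6)[OF \<open>t \<in> J\<close>] bound[OF t] by (auto intro: deriv_mono deriv_pos)
    then have "t * deriv \<phi> (u t) \<le> \<beta> * deriv \<phi> B" "0 \<le> \<beta> * deriv \<phi> B"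
      using t by (auto intro!: mult_mono)
    then show ?thesis
      using graph_solution_slope_bounds(2)[OF u \<open>t \<in> J\<close>] D(5) t by (cases "t = 0") auto
  qed
  obtain M where M: "(deriv u \<longlongrightarrow> M) (at_left \<beta>)"
    by (rule mono_bounded_tendsto_at_left[of 0 \<beta> "deriv u" "\<beta> * deriv \<phi> B"])
      (use graph_solution_deriv_mono[OF u] sub assms(2) slope in \<open>auto simp: subset_iff\<close>)
  obtain \<beta>2 v w where \<beta>2: "\<beta> < \<beta>2" and init: "v \<beta> = L" "w \<beta> = M"
    and cont: "continuous_on {\<beta>..\<beta>2} v" "continuous_on {\<beta>..\<beta>2} w"
    and dom: "\<And>t. t \<in> {\<beta>..\<beta>2} \<Longrightarrow> v t \<in> einterval a \<infinity>"
    and v': "\<And>t. \<beta> < t \<Longrightarrow> t < \<beta>2 \<Longrightarrow> (v has_real_derivative w t) (at t)"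
    and w': "\<And>t. \<beta> < t \<Longrightarrow> t < \<beta>2 \<Longrightarrow>
      (w has_real_derivative (1 + (w t)\<^sup>2) * (deriv \<phi> (v t) - w t / t)) (at t)"
    using graph_equation_local_existence[OF assms(2) L_dom, of M] by metis
  define U where "U t = (if t < \<beta> then u t else v t)" for t
  define W where "W t = (if t < \<beta> then deriv u t else w t)" for t
  define Q where "Q t = (if t < \<beta> then deriv (deriv u) t
    else (1 + (w t)\<^sup>2) * (deriv \<phi> (v t) - w t / t))" for t
  \<comment> \<open>The added interval overlaps \<open>J\<close> on ]0, \<beta>[, so the union is
    open and connected, contains \<beta>, and leaves the left end of \<open>J\<close> as it
    was.\<close>
  define K where "K = J \<union> {0<..<\<beta>2}"
  have K_cases: "t \<in> J \<and> t < \<beta> \<or> t = \<beta> \<or> \<beta> < t \<and> t < \<beta>2" if "t \<in> K" for t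
  proof (cases "t \<in> J")
    case False
    then have "0 < t" "t < \<beta>2" "\<not> t < \<beta>" using that sub by (auto simp: K_def subset_iff)
    then show ?thesis by auto
  qed (use J\<beta> in auto)
  have U_dom: "U t \<in> einterval a \<infinity>" if "t \<in> K" for t
    using K_cases[OF that] D(6) dom \<beta>2 by (auto simp: U_def)
  have Q_eq: "Q t = (1 + (W t)\<^sup>2) * (deriv \<phi> (U t) - W t / t)" if "t \<in> K" "t \<noteq> 0" for t
    using K_cases[OF that(1)] D(10)[of t] that(2) by (auto simp: Q_def W_def U_def)
  have isCont_\<beta>: "isCont U \<beta>" "isCont W \<beta>"
  proof -
    have right: "(v \<longlongrightarrow> L) (at_right \<beta>)" "(w \<longlongrightarrow> M) (at_right \<beta>)"
      using continuous_on_Icc_at_rightD[OF cont(1) \<beta>2] continuous_on_Icc_at_rightD[OF cont(2) \<beta>2] init by auto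
    have ev: "\<forall>\<^sub>F t in at_left \<beta>. t < \<beta>" "\<forall>\<^sub>F t in at_right \<beta>. \<beta> < t"
      by (auto simp: eventually_at_filter)
    have "(U \<longlongrightarrow> L) (at_left \<beta>)" "(W \<longlongrightarrow> M) (at_left \<beta>)"
      by (rule Lim_transform_eventually[OF L(1)] Lim_transform_eventually[OF M],
          rule eventually_mono[OF ev(1)], simp add: U_def W_def)+
    moreover have "(U \<longlongrightarrow> L) (at_right \<beta>)" "(W \<longlongrightarrow> M) (at_right \<beta>)"
      by (rule Lim_transform_eventually[OF right(1)] Lim_transform_eventually[OF right(2)],
          rule eventually_mono[OF ev(2)], simp add: U_def W_def)+
    ultimately show "isCont U \<beta>" "isCont W \<beta>"
      by (auto simp: isCont_def filterlim_split_at U_def W_def init)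
  qed
  have open_K: "open K" "0 \<in> K" "\<beta> \<in> K"
    using D(1,3) assms(2) \<beta>2 by (auto simp: K_def)
  have off: "(U has_real_derivative W t) (at t)" "(W has_real_derivative Q t) (at t)"
    if t: "t \<in> K" "t \<noteq> \<beta>" for t
  proof -
    consider "t \<in> J" "t < \<beta>" | "\<beta> < t" "t < \<beta>2" using K_cases[OF t(1)] t(2) by blast
    then have "(U has_real_derivative W t) (at t) \<and> (W has_real_derivative Q t) (at t)"
    proof cases
      case 1
      have "(U has_real_derivative deriv u t) (at t)"
        by (rule has_field_derivative_transform_within_open[OF D(7)[OF 1(1)] D(1) 1(1)])
          (simp add: U_def J\<beta>)
      moreover have "(W has_real_derivative deriv (deriv u) t) (at t)"
        by (rule has_field_derivative_transform_within_open[OF D(8)[OF 1(1)] D(1) 1(1)])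
          (simp add: W_def J\<beta>)
      ultimately show ?thesis using 1 by (simp add: W_def Q_def)
    next
      case 2
      then have mem: "t \<in> {\<beta><..<\<beta>2}" by simp
      have "(U has_real_derivative w t) (at t)"
        by (rule has_field_derivative_transform_within_open[OF v'[OF 2] open_greaterThanLessThan mem])
          (simp add: U_def)
      moreover have "(W has_real_derivative (1 + (w t)\<^sup>2) * (deriv \<phi> (v t) - w t / t)) (at t)"
        by (rule has_field_derivative_transform_within_open[OF w'[OF 2] open_greaterThanLessThan mem])
          (simp add: W_def)
      ultimately show ?thesis using 2 by (simp add: W_def Q_def)
    qed
    then show "(U has_real_derivative W t) (at t)" "(W has_real_derivative Q t) (at t)" by blast+
  qed
  have "isCont U t" "isCont W t" if "t \<in> K" for t
    using off[OF that] isCont_\<beta> DERIV_isCont by (cases "t = \<beta>"; blast)+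
  then have UW_cont: "continuous_on K U" "continuous_on K W"
    by (auto intro: continuous_at_imp_continuous_on)
  \<comment> \<open>Continuity of the second derivative across \<beta> comes from the equation
    itself, which expresses it through the continuous functions \<open>U\<close> and
    \<open>W\<close> away from x = 0. Near 0 the old solution takes over.\<close>
  have "continuous_on {0<..<\<beta>2} (\<lambda>t. (1 + (W t)\<^sup>2) * (deriv \<phi> (U t) - W t / t))"
    by (intro continuous_intros continuous_on_compose2[OF deriv_cont]
        continuous_on_subset[OF UW_cont(1)] continuous_on_subset[OF UW_cont(2)])
      (use U_dom in \<open>auto simp: K_def\<close>)
  then have "continuous_on {0<..<\<beta>2} Q"
    by (rule continuous_on_eq) (use Q_eq in \<open>auto simp: K_def\<close>)
  moreover have "continuous_on J Q"
    by (rule continuous_on_eq[OF D(9)]) (simp add: Q_def J\<beta>)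
  ultimately have Q_cont: "continuous_on K Q"
    unfolding K_def by (intro continuous_on_open_Un D(1)) auto
  have "isCont Q \<beta>"
    using Q_cont open_K by (simp add: continuous_on_eq_continuous_at)
  \<comment> \<open>Differentiability at the junction follows from continuity there and the limits
    of the derivatives.\<close>
  then have at_\<beta>: "(U has_real_derivative W \<beta>) (at \<beta>)" "(W has_real_derivative Q \<beta>) (at \<beta>)"
    using isCont_\<beta>(2) off
    by (auto intro!: has_real_derivative_if_tendsto[OF open_K(1,3)] UW_cont simp: isCont_def)
  have "graph_solution \<phi> a z0 K U"
  proof (rule graph_solutionI)
    have "connected K"
      unfolding K_def using D(2) sub assms(2) \<beta>2
      by (intro connected_Un) (auto simp: is_interval_connected_1 disjoint_iff intro!: exI[of _ "\<beta> / 2"])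
    then show "open_interval_at_0 K"
      using open_K by (simp add: open_interval_at_0_def is_interval_connected_1)
    show "(U has_real_derivative W t) (at t)" "(W has_real_derivative Q t) (at t)" if "t \<in> K" for t
      using off[OF that] at_\<beta> by (cases "t = \<beta>"; simp)+
    show "U 0 = z0" "W 0 = 0" using assms(2) D(4,5) by (simp_all add: U_def W_def)
  qed (use Q_cont U_dom Q_eq in auto)
  moreover have "J \<subset> K" using open_K(3) assms(3) by (auto simp: K_def)
  moreover have "U t = u t" if "t \<in> J" for t using J\<beta>[OF that] by (simp add: U_def)
  ultimately show thesis using that by blast
qed

text \<open>On an unbounded domain convexity alone suffices: u stays above a tangent line. The
  tangent is taken at 1 because the one at 0 is horizontal.\<close>

lemma graph_solution_at_top:
  assumes u: "graph_solution \<phi> a z0 UNIV u"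
  shows "filterlim u at_top at_top"
proof (rule filterlim_at_top_mono)
  have pos: "deriv u 1 > 0"
    using graph_solution_slope_bounds(1)[OF u] by simp
  show "filterlim (\<lambda>x. u 1 + (x - 1) * deriv u 1) at_top at_top"
    using filterlim_tendsto_add_at_top[OF tendsto_const filterlim_ident, of "- 1"] pos
    by (intro filterlim_tendsto_add_at_top[OF tendsto_const]
        filterlim_at_top_mult_tendsto_pos[OF tendsto_const]) simp_all
  show "\<forall>\<^sub>F x in at_top. u 1 + (x - 1) * deriv u 1 \<le> u x"
    using eventually_gt_at_top[of 1]
  proof eventually_elim
    case (elim x)
    then obtain \<xi> where \<xi>: "1 < \<xi>" "u x - u 1 = (x - 1) * deriv u \<xi>"
      using MVT2[of 1 x u "deriv u"] graph_solutionD(7)[OF u] by auto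
    moreover have "deriv u 1 \<le> deriv u \<xi>"
      using graph_solution_deriv_mono[OF u] \<xi> by simp
    ultimately show ?case
      using mult_left_mono[of "deriv u 1" "deriv u \<xi>" "x - 1"] elim by linarith
  qed
qed

text \<open>A bounded solution could be continued, against maximality; an unbounded nondecreasing
  one tends to infinity.\<close>

lemma maximal_graph_solution_at_left:
  assumes max: "maximal_graph_solution \<phi> a z0 {- \<beta><..<\<beta>} u"
  shows "filterlim u at_top (at_left \<beta>)"
proof -
  have u: "graph_solution \<phi> a z0 {- \<beta><..<\<beta>} u"
    using max by (simp add: maximal_graph_solution_def)
  have \<beta>: "\<beta> > 0" using graph_solutionD(3)[OF u] by simp
  have "\<exists>t. 0 \<le> t \<and> t < \<beta> \<and> B < u t" for B
  proof (rule ccontr)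
    assume "\<nexists>t. 0 \<le> t \<and> t < \<beta> \<and> B < u t"
    then have "\<And>t. 0 \<le> t \<Longrightarrow> t < \<beta> \<Longrightarrow> u t \<le> B" by force
    then obtain K v where
      "graph_solution \<phi> a z0 K v" "{- \<beta><..<\<beta>} \<subset> K" "\<forall>t\<in>{- \<beta><..<\<beta>}. v t = u t"
      using \<beta> by (elim graph_solution_extend[OF u \<beta>, of B, rotated 2]) auto
    with max show False
      unfolding maximal_graph_solution_def by blast
  qed
  then show ?thesis
    unfolding filterlim_at_top
  proof (intro allI)
    fix B
    obtain t where t: "0 \<le> t" "t < \<beta>" "B < u t" using \<open>\<And>B. \<exists>t. 0 \<le> t \<and> t < \<beta> \<and> B < u t\<close> by blast
    show "\<forall>\<^sub>F x in at_left \<beta>. B \<le> u x"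
      using eventually_at_left_real[OF t(2)]
    proof eventually_elim
      case (elim x)
      then have "u t \<le> u x" using t by (intro graph_solution_mono[OF u]) auto
      with t show ?case by simp
    qed
  qed
qed

text \<open>Finite and infinite end points are treated by the two preceding lemmas, after
  translating neighbourhoods of extended reals into filters on \<real>. Evenness transfers the limit
  to the left end.\<close>

lemma maximal_graph_solution_limits:
  assumes max: "maximal_graph_solution \<phi> a z0 (einterval (- \<omega>) \<omega>) u" and "\<omega> > 0"
  shows "filterlim (u \<circ> real_of_ereal) at_top (at_left \<omega>)"
    and "filterlim (u \<circ> real_of_ereal) at_top (at_right (- \<omega>))"
proof -
  have "filterlim (u \<circ> real_of_ereal) at_top (at_left \<omega>) \<and>
    filterlim (u \<circ> real_of_ereal) at_top (at_right (- \<omega>))"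
  proof (cases \<omega>)
    case (real \<beta>)
    then have max': "maximal_graph_solution \<phi> a z0 {- \<beta><..<\<beta>} u" using max by simp
    note left = maximal_graph_solution_at_left[OF max']
    have "\<beta> > 0" using assms(2) real by simp
    then have "\<forall>\<^sub>F t in at_left \<beta>. u t = u (- t)"
      using eventually_at_left_real[of "- \<beta>" \<beta>] maximal_graph_solution_even(2)[OF max']
      by (auto elim!: eventually_mono)
    then have "filterlim (\<lambda>t. u (- t)) at_top (at_left \<beta>)"
      using left by (simp add: filterlim_cong)
    then have "filterlim u at_top (at_right (- \<beta>))"
      by (simp add: at_right_minus[of "- \<beta>"] filterlim_filtermap)
    with left show ?thesis
      by (simp add: real at_left_ereal at_right_ereal filterlim_filtermap o_def)
  next
    case PInf
    then have max': "maximal_graph_solution \<phi> a z0 UNIV u" using max by simp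
    then have top: "filterlim u at_top at_top"
      unfolding maximal_graph_solution_def by (blast intro: graph_solution_at_top)
    then have "filterlim u at_top at_bot"
      using maximal_graph_solution_even(2)[OF max'] by (simp add: filterlim_at_bot_mirror)
    with top show ?thesis
      by (simp add: PInf at_left_PInf at_right_MInf filterlim_filtermap o_def)
  next
    case MInf
    with assms(2) show ?thesis by simp
  qed
  then show "filterlim (u \<circ> real_of_ereal) at_top (at_left \<omega>)"
    "filterlim (u \<circ> real_of_ereal) at_top (at_right (- \<omega>))" by blast+
qed

end

section \<open>Assembly of the theorem\<close>

lemma weightI:
  assumes smooth: "smooth_on_open \<phi> (einterval a \<infinity>)"
    and "\<And>t. t \<in> einterval a \<infinity> \<Longrightarrow> deriv \<phi> t > 0"
    and "\<And>t. t \<in> einterval a \<infinity> \<Longrightarrow> deriv (deriv \<phi>) t \<ge> 0"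
  shows "weight \<phi> a"
proof
  have diff: "(deriv ^^ k) \<phi> differentiable at t" if "t \<in> einterval a \<infinity>" for k t
    using smooth that by (simp add: smooth_on_open_def)
  \<comment> \<open>The index counts the derivatives already taken: 1 makes \<phi>' differentiable,
    and 2, below, makes \<phi>'' continuous.\<close>
  show "(deriv \<phi> has_real_derivative deriv (deriv \<phi>) t) (at t)" if "t \<in> einterval a \<infinity>" for t
    using diff[OF that, of 1] by (simp add: real_differentiable_def) (metis DERIV_imp_deriv)
  have "isCont (deriv (deriv \<phi>)) t" if "t \<in> einterval a \<infinity>" for t
    using diff[OF that, of 2] by (simp add: numeral_2_eq_2 differentiable_imp_continuous_within)
  then show "continuous_on (einterval a \<infinity>) (deriv (deriv \<phi>))"
    by (simp add: continuous_at_imp_continuous_on)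
qed (use assms in auto)

text \<open>Reflection exchanges infimum and supremum, so the infimum is the negative of the
  supremum, which may be infinite.\<close>

lemma symmetric_open_interval:
  fixes J :: "real set"
  assumes "open J" and "is_interval J" and "0 \<in> J" and sym: "uminus ` J = J"
  obtains \<omega> :: ereal where "\<omega> > 0" "J = einterval (- \<omega>) \<omega>"
proof -
  define \<omega> where "\<omega> = (SUP x\<in>J. ereal x)"
  have "(INF x\<in>J. ereal x) = (INF x\<in>uminus ` J. ereal x)" by (simp only: sym)
  also have "\<dots> = (INF x\<in>J. - ereal x)" by (simp add: image_image)
  also have "\<dots> = - \<omega>" unfolding \<omega>_def by (rule ereal_INF_uminus_eq)
  finally have J: "J = einterval (- \<omega>) \<omega>"
    using einterval_Inf_Sup[OF assms(1,2)] assms(3) by (auto simp: \<omega>_def)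
  moreover have "\<omega> > 0"
    using assms(3) unfolding J by (simp add: einterval_iff zero_ereal_def)
  ultimately show thesis using that by blast
qed

theorem theorem4p5:
  fixes \<phi> :: "real \<Rightarrow> real" and a :: ereal and z0 :: real
    and I :: "real set" and x z \<theta> :: "real \<Rightarrow> real"
  assumes "smooth_on_open \<phi> (einterval a \<infinity>)"
    and "\<And>t. t \<in> einterval a \<infinity> \<Longrightarrow> deriv \<phi> t > 0"
    and "\<And>t. t \<in> einterval a \<infinity> \<Longrightarrow> deriv (deriv \<phi>) t \<ge> 0"
    and "z0 \<in> einterval a \<infinity>"
    and "maximal_generating_curve \<phi> a z0 I x z \<theta>"
  shows "\<exists>(\<omega> :: ereal) (u :: real \<Rightarrow> real).
    0 < \<omega> \<and>
    planar_curve x z ` I = graph_over u (einterval (- \<omega>) \<omega>) \<and>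
    maximal_graph_solution \<phi> a z0 (einterval (- \<omega>) \<omega>) u \<and>
    strictly_convex_on (einterval (- \<omega>) \<omega>) u \<and>
    (\<forall>t \<in> einterval (- \<omega>) \<omega>. u (- t) = u t) \<and>
    (\<forall>t \<in> einterval (- \<omega>) \<omega>. u 0 \<le> u t) \<and>
    filterlim (u \<circ> real_of_ereal) at_top (at_left \<omega>) \<and>
    filterlim (u \<circ> real_of_ereal) at_top (at_right (- \<omega>))"
proof -
  interpret weight \<phi> a using assms(1-3) by (rule weightI)
  obtain u where max: "maximal_graph_solution \<phi> a z0 (x ` I) u"
    and graph: "planar_curve x z ` I = graph_over u (x ` I)"
    using maximal_generating_curve_graph[OF assms(5)] by blast
  then have u: "graph_solution \<phi> a z0 (x ` I) u"
    by (simp add: maximal_graph_solution_def)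
  note even = maximal_graph_solution_even[OF max]
  obtain \<omega> :: ereal where \<omega>: "\<omega> > 0" and J: "x ` I = einterval (- \<omega>) \<omega>"
    using symmetric_open_interval[OF graph_solutionD(1-3)[OF u] even(1)] by blast
  \<comment> \<open>The function is nondecreasing to the right of 0, and evenness moves any point
    there.\<close>
  have "u 0 \<le> u t" if t: "t \<in> x ` I" for t
  proof -
    have "\<bar>t\<bar> \<in> x ` I" "u \<bar>t\<bar> = u t"
      using t even by (auto simp: abs_if)
    then show ?thesis using graph_solution_mono[OF u, of 0 "\<bar>t\<bar>"] by simp
  qed
  then have min: "\<forall>t\<in>x ` I. u 0 \<le> u t" by blast
  note limits = maximal_graph_solution_limits[OF max[unfolded J] \<omega>]
  show ?thesis
    using \<omega> graph max graph_solution_strictly_convex[OF u] even(2) min limits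
    unfolding J by (intro exI[of _ \<omega>] exI[of _ u] conjI ballI) simp_all
qed

end
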